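(* Let $F_1$ be a reproducing kernel Hilbert space of real functions on $D_1\subset\mathbb{R}$, let $G_1$ be a real Hilbert space, and let $S_1:F_1\to G_1$ be a non-zero compact linear operator. Let $\lambda_1\ge\lambda_2\ge\cdots\ge 0$ be the eigenvalues of $S_1^*S_1$, assume $\lambda_2<\lambda_1$, and let $\eta_1\in F_1$ satisfy $S_1^*S_1\eta_1=\lambda_1\eta_1$ and $\|\eta_1\|_{F_1}=1$. For $d=1,2,\dots$ let $F_d=F_1^{\otimes d}$, $G_d=G_1^{\otimes d}$, $S_d=S_1^{\otimes d}:F_d\to G_d$, and let $I_d=I_1^{\otimes d}:F_d\to\mathbb{R}$, where $I_1f=\langle f,\lambda_1^{1/2}\eta_1\rangle_{F_1}$ for $f\in F_1$. Put $\mathbb{S}=\{S_d\}_{d=1}^\infty$ and $\mathbb{I}=\{I_d\}_{d=1}^\infty$. Then, for the class $\Lambda^{\rm std}$, every negative tractability result for $\mathbb{I}$ carries over to $\mathbb{S}$, that is: (i) if $\mathbb{I}$ suffers from the curse of dimensionality for $\Lambda^{\rm std}$, then so does $\mathbb{S}$; (ii) if $\mathbb{I}$ is not quasi-polynomially tractable for $\Lambda^{\rm std}$, then $\mathbb{S}$ is not quasi-polynomially tractable for $\Lambda^{\rm std}$; (iii) if $\mathbb{I}$ is not polynomially tractable for $\Lambda^{\rm std}$, then $\mathbb{S}$ is not polynomially tractable for $\Lambda^{\rm std}$.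
   Context: Tensor products are Hilbert space tensor products of $d$ copies. $F_d$ is identified with the reproducing kernel Hilbert space of real functions on $D_d=D_1^d$ with kernel $K_d(x,y)=\prod_{j=1}^dK_1(x_j,y_j)$, where $K_1$ is the reproducing kernel of $F_1$. Thus $I_df=\langle f,\lambda_1^{d/2}\,\eta_1\otimes\cdots\otimes\eta_1\rangle_{F_d}$, where $(\eta_1\otimes\cdots\otimes\eta_1)(x)=\prod_{k=1}^d\eta_1(x_k)$. Eigenvalues are listed with multiplicity, and the list is extended by zeros if $\dim F_1<\infty$. For a continuous linear operator $T:F_d\to H$ into a real Hilbert space $H$ (for a functional, $H=\mathbb{R}$), let $\Lambda^{\rm std}$ be the set of all function evaluations $f\mapsto f(t)$, $t\in D_d$. For $n\ge 1$, $$e_n(T,\Lambda^{\rm std})=\inf_{L_1,\dots,L_n\in\Lambda^{\rm std},\,g_1,\dots,g_n\in H}\ \sup_{\|f\|_{F_d}\le1}\Big\|Tf-\sum_{j=1}^nL_j(f)g_j\Big\|_H,$$ and $e_0(T)=e_0(T,\Lambda^{\rm std})=\|T\|$. The information complexity (normalized error criterion) is $n(\varepsilon,T,\Lambda^{\rm std})=\min\{n\ge 0:\ e_n(T,\Lambda^{\rm std})\le\varepsilon\,e_0(T)\}$ for $\varepsilon\in(0,1)$. A sequence $\mathbb{T}=\{T_d\}_{d=1}^\infty$ of such operators on $F_d$: - suffers from the curse of dimensionality for $\Lambda^{\rm std}$ iff there are positive $c,C$ and $\varepsilon_0\in(0,1)$ such that $n(\varepsilon,T_d,\Lambda^{\rm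 std})\ge C(1+c)^d$ for all $\varepsilon\in(0,\varepsilon_0]$ and infinitely many $d$; - is quasi-polynomially tractable for $\Lambda^{\rm std}$ iff there are non-negative $C,t$ such that $n(\varepsilon,T_d,\Lambda^{\rm std})\le C\exp\big(t(1+\ln\varepsilon^{-1})(1+\ln d)\big)$ for all $\varepsilon\in(0,1)$ and $d=1,2,\dots$; - is polynomially tractable for $\Lambda^{\rm std}$ iff there are non-negative $C,p,q$ such that $n(\varepsilon,T_d,\Lambda^{\rm std})\le C\varepsilon^{-p}d^{\,q}$ for all $\varepsilon\in(0,1)$ and $d=1,2,\dots$. *)

theory Defs
  imports "HOL-Analysis.Analysis"
begin

section \<open>Positive semidefinite kernels\<close>

definition psd_on :: "'i set \<Rightarrow> ('i \<Rightarrow> 'i \<Rightarrow> real) \<Rightarrow> bool" where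
  "psd_on A a \<longleftrightarrow> (\<forall>i\<in>A. \<forall>j\<in>A. a i j = a j i) \<and>
     (\<forall>c. 0 \<le> (\<Sum>i\<in>A. \<Sum>j\<in>A. c i * c j * a i j))"

lemma psd_onD:
  assumes "psd_on A a"
  shows "0 \<le> (\<Sum>i\<in>A. \<Sum>j\<in>A. c i * c j * a i j)"
  using assms unfolding psd_on_def by blast

lemma quad_insert:
  fixes a :: "'i \<Rightarrow> 'i \<Rightarrow> real"
  assumes "finite A" "p \<notin> A" "\<And>i. i \<in> A \<Longrightarrow> a i p = a p i"
  shows "(\<Sum>i\<in>insert p A. \<Sum>j\<in>insert p A. c i * c j * a i j) =
         c p * c p * a p p + 2 * c p * (\<Sum>i\<in>A. c i * a p i) + (\<Sum>i\<in>A. \<Sum>j\<in>A. c i * c j * a i j)"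
proof -
  have "(\<Sum>i\<in>A. c i * c p * a i p) = c p * (\<Sum>i\<in>A. c i * a p i)"
    using assms(3) by (simp add: sum_distrib_left mult_ac)
  moreover have "(\<Sum>j\<in>A. c p * c j * a p j) = c p * (\<Sum>i\<in>A. c i * a p i)"
    by (simp add: sum_distrib_left mult_ac)
  ultimately show ?thesis
    using assms(1,2) by (simp add: sum.distrib)
qed

lemma psd_on_diag:
  assumes "finite A" "psd_on A a" "p \<in> A" shows "0 \<le> a p p"
proof -
  have "0 \<le> (\<Sum>i\<in>A. \<Sum>j\<in>A. (if i = p then 1 else 0) * (if j = p then 1 else 0) * a i j)"
    by (rule psd_onD[OF assms(2)])
  also have "\<dots> = (\<Sum>i\<in>A. if i = p then (\<Sum>j\<in>A. if j = p then a p p else 0) else 0)"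
    by (intro sum.cong refl) (auto intro!: sum.cong)
  also have "\<dots> = a p p" using assms by simp
  finally show ?thesis .
qed

lemma psd_on_subset:
  assumes "finite A" "psd_on A a" "B \<subseteq> A" shows "psd_on B a"
  unfolding psd_on_def
proof (intro conjI ballI allI)
  fix c :: "'a \<Rightarrow> real"
  have "(\<Sum>i\<in>B. \<Sum>j\<in>B. c i * c j * a i j)
      = (\<Sum>i\<in>A. \<Sum>j\<in>A. (if i \<in> B then c i else 0) * (if j \<in> B then c j else 0) * a i j)"
  proof -
    have 1: "(\<Sum>j\<in>A. (if i \<in> B then c i else 0) * (if j \<in> B then c j else 0) * a i j)
        = (if i \<in> B then (\<Sum>j\<in>B. c i * c j * a i j) else 0)" for i
    proof (cases "i \<in> B")
      case True
      have "(\<Sum>j\<in>B. c i * c j * a i j) = (\<Sum>j\<in>B. c i * (if j \<in> B then c j else 0) * a i j)"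
        by (intro sum.cong) auto
      also have "\<dots> = (\<Sum>j\<in>A. c i * (if j \<in> B then c j else 0) * a i j)"
        using assms by (intro sum.mono_neutral_left) auto
      finally show ?thesis using True by simp
    qed simp
    have "(\<Sum>i\<in>B. \<Sum>j\<in>B. c i * c j * a i j)
        = (\<Sum>i\<in>B. if i \<in> B then (\<Sum>j\<in>B. c i * c j * a i j) else 0)"
      by (intro sum.cong) auto
    also have "\<dots> = (\<Sum>i\<in>A. if i \<in> B then (\<Sum>j\<in>B. c i * c j * a i j) else 0)"
      using assms by (intro sum.mono_neutral_left) auto
    finally show ?thesis unfolding 1 .
  qed
  also have "\<dots> \<ge> 0" by (rule psd_onD[OF assms(2)])
  finally show "0 \<le> (\<Sum>i\<in>B. \<Sum>j\<in>B. c i * c j * a i j)" .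
qed (use assms in \<open>auto simp: psd_on_def\<close>)

lemma psd_on_zero_diag:
  assumes "finite A" "psd_on A a" "p \<in> A" "j \<in> A" "a p p = 0" shows "a p j = 0"
proof (cases "j = p")
  case False
  have ps: "psd_on (insert p {j}) a" using assms by (auto intro: psd_on_subset[OF assms(1,2)])
  have sym: "a j p = a p j" using ps unfolding psd_on_def by blast
  have "0 \<le> 2 * t * a p j + a j j" for t
  proof -
    have "0 \<le> (\<Sum>i\<in>insert p {j}. \<Sum>l\<in>insert p {j}. (if i = p then t else 1) * (if l = p then t else 1) * a i l)"
      by (rule psd_onD[OF ps])
    also have "\<dots> = 2 * t * a p j + a j j"
      using False by (subst quad_insert) (simp_all add: assms(5) sym)
    finally show ?thesis .
  qed
  from this[of "(- a j j - 1) / (2 * a p j)"] show ?thesis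
    by (cases "a p j = 0") (auto simp: field_simps)
qed (use assms in auto)

text \<open>The Schur product theorem, proved by eliminating one index at a time.\<close>

lemma psd_on_hadamard:
  assumes "finite A" "psd_on A a" "psd_on A b"
  shows "0 \<le> (\<Sum>i\<in>A. \<Sum>j\<in>A. a i j * b i j)"
  using assms
proof (induction A arbitrary: a rule: finite_induct)
  case (insert p A)
  have fin: "finite (insert p A)" using insert by simp
  have sym: "a i j = a j i" if "i \<in> insert p A" "j \<in> insert p A" for i j
    using insert.prems(1) that unfolding psd_on_def by blast
  define a' where "a' = (\<lambda>i j. a i j - a p i * a p j / a p p)"
  have app: "0 \<le> a p p" using psd_on_diag[OF fin insert.prems(1)] by simp
  have z: "a' p j = 0" "a' j p = 0" if "j \<in> insert p A" for j
    using psd_on_zero_diag[OF fin insert.prems(1), of p j] that sym[of j p]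
    by (auto simp: a'_def)
  have psd': "psd_on A a'"
    unfolding psd_on_def
  proof (intro conjI ballI allI)
    fix c :: "'a \<Rightarrow> real"
    define s where "s = (\<Sum>i\<in>A. c i * a p i)"
    define d where "d = (\<lambda>i. if i = p then - s / a p p else c i)"
    have dA: "d i = c i" if "i \<in> A" for i using that insert.hyps by (auto simp: d_def)
    have "(\<Sum>i\<in>A. \<Sum>j\<in>A. c i * c j * a' i j)
        = (\<Sum>i\<in>A. \<Sum>j\<in>A. c i * c j * a i j) - (\<Sum>i\<in>A. \<Sum>j\<in>A. (c i * a p i) * (c j * a p j)) / a p p"
      by (simp add: a'_def algebra_simps sum_subtractf sum_divide_distrib)
    also have "(\<Sum>i\<in>A. \<Sum>j\<in>A. (c i * a p i) * (c j * a p j)) = s * s"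
      unfolding s_def by (simp add: sum_product)
    also have "(\<Sum>i\<in>A. \<Sum>j\<in>A. c i * c j * a i j) - s * s / a p p
        = d p * d p * a p p + 2 * d p * (\<Sum>i\<in>A. d i * a p i) + (\<Sum>i\<in>A. \<Sum>j\<in>A. d i * d j * a i j)"
    proof -
      have "(\<Sum>i\<in>A. d i * a p i) = s" unfolding s_def using dA by (intro sum.cong) auto
      moreover have "(\<Sum>i\<in>A. \<Sum>j\<in>A. d i * d j * a i j) = (\<Sum>i\<in>A. \<Sum>j\<in>A. c i * c j * a i j)"
        using dA by (intro sum.cong) auto
      moreover have "d p = - s / a p p" by (simp add: d_def)
      ultimately show ?thesis by (cases "a p p = 0") (auto simp: field_simps)
    qed
    also have "\<dots> = (\<Sum>i\<in>insert p A. \<Sum>j\<in>insert p A. d i * d j * a i j)"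
      using insert.hyps sym by (intro quad_insert[symmetric]) auto
    also have "\<dots> \<ge> 0" using insert.prems(1) unfolding psd_on_def by blast
    finally show "0 \<le> (\<Sum>i\<in>A. \<Sum>j\<in>A. c i * c j * a' i j)" .
  qed (use sym in \<open>auto simp: a'_def\<close>)
  have "psd_on A b" by (rule psd_on_subset[OF fin insert.prems(2)]) auto
  from insert.IH[OF psd' this]
  have IH: "0 \<le> (\<Sum>i\<in>A. \<Sum>j\<in>A. a' i j * b i j)" .
  have "(\<Sum>i\<in>insert p A. \<Sum>j\<in>insert p A. a i j * b i j)
      = (\<Sum>i\<in>insert p A. \<Sum>j\<in>insert p A. a' i j * b i j)
        + (\<Sum>i\<in>insert p A. \<Sum>j\<in>insert p A. a p i * a p j * b i j) / a p p"
    unfolding sum_divide_distrib sum.distrib[symmetric]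
    by (intro sum.cong refl) (simp add: a'_def algebra_simps)
  moreover have "(\<Sum>i\<in>insert p A. \<Sum>j\<in>insert p A. a' i j * b i j) = (\<Sum>i\<in>A. \<Sum>j\<in>A. a' i j * b i j)"
    using insert.hyps z by simp
  moreover have "0 \<le> (\<Sum>i\<in>insert p A. \<Sum>j\<in>insert p A. a p i * a p j * b i j)"
    using insert.prems(2) unfolding psd_on_def by blast
  ultimately show ?case using IH app by simp
qed simp

definition psd_kernel :: "('x \<Rightarrow> 'x \<Rightarrow> real) \<Rightarrow> bool" where
  "psd_kernel k \<longleftrightarrow> (\<forall>x y. k x y = k y x) \<and>
     (\<forall>n (x :: nat \<Rightarrow> 'x) c. 0 \<le> (\<Sum>i<n. \<Sum>j<n. c i * c j * k (x i) (x j)))"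

lemma psd_kernelD:
  assumes "psd_kernel k"
  shows "k x y = k y x" "0 \<le> (\<Sum>i<n::nat. \<Sum>j<n. c i * c j * k (z i) (z j))"
  using assms unfolding psd_kernel_def by blast+

lemma psd_kernel_on:
  assumes "psd_kernel k"
  shows "psd_on {..<n::nat} (\<lambda>i j. c i * c j * k (x i) (x j))"
  unfolding psd_on_def
proof (intro conjI ballI allI)
  fix b :: "nat \<Rightarrow> real"
  have "0 \<le> (\<Sum>i<n. \<Sum>j<n. (b i * c i) * (b j * c j) * k (x i) (x j))"
    by (rule psd_kernelD(2)[OF assms])
  then show "0 \<le> (\<Sum>i<n. \<Sum>j<n. b i * b j * (c i * c j * k (x i) (x j)))"
    by (simp add: mult_ac)
next
  fix i j
  show "c i * c j * k (x i) (x j) = c j * c i * k (x j) (x i)"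
    by (simp only: psd_kernelD(1)[OF assms, of "x i" "x j"] mult.commute[of "c i" "c j"])
qed

lemma psd_kernel_mult:
  assumes "psd_kernel k" "psd_kernel l"
  shows "psd_kernel (\<lambda>x y. k x y * l x y)"
  unfolding psd_kernel_def
proof (intro conjI allI)
  fix n :: nat and x :: "nat \<Rightarrow> 'a" and c :: "nat \<Rightarrow> real"
  have "0 \<le> (\<Sum>i<n. \<Sum>j<n. (c i * c j * k (x i) (x j)) * (1 * 1 * l (x i) (x j)))"
    by (intro psd_on_hadamard psd_kernel_on assms finite_lessThan
          psd_kernel_on[OF assms(2), where c = "\<lambda>_. 1"])
  then show "0 \<le> (\<Sum>i<n. \<Sum>j<n. c i * c j * (k (x i) (x j) * l (x i) (x j)))"
    by (simp add: mult_ac)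
next
  fix x y
  show "k x y * l x y = k y x * l y x"
    by (simp only: psd_kernelD(1)[OF assms(1), of x y] psd_kernelD(1)[OF assms(2), of x y])
qed

lemma psd_kernel_add:
  assumes "psd_kernel k" "psd_kernel l"
  shows "psd_kernel (\<lambda>x y. k x y + l x y)"
  unfolding psd_kernel_def
proof (intro conjI allI)
  fix n :: nat and x :: "nat \<Rightarrow> 'a" and c :: "nat \<Rightarrow> real"
  show "0 \<le> (\<Sum>i<n. \<Sum>j<n. c i * c j * (k (x i) (x j) + l (x i) (x j)))"
    using psd_kernelD(2)[OF assms(1), where n = n and c = c and z = x] psd_kernelD(2)[OF assms(2), where n = n and c = c and z = x]
    by (simp add: algebra_simps sum.distrib)
next
  fix x y
  show "k x y + l x y = k y x + l y x"
    by (simp only: psd_kernelD(1)[OF assms(1), of x y] psd_kernelD(1)[OF assms(2), of x y])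
qed

lemma psd_kernel_weight:
  assumes "psd_kernel k"
  shows "psd_kernel (\<lambda>x y. w x * w y * k (f x) (f y))"
  unfolding psd_kernel_def
proof (intro conjI allI)
  fix n :: nat and x :: "nat \<Rightarrow> 'b" and c :: "nat \<Rightarrow> real"
  show "0 \<le> (\<Sum>i<n. \<Sum>j<n. c i * c j * (w (x i) * w (x j) * k (f (x i)) (f (x j))))"
    using psd_kernelD(2)[OF assms, where n = n and c = "\<lambda>i. c i * w (x i)" and z = "\<lambda>i. f (x i)"]
    by (simp add: mult_ac)
next
  fix x y
  show "w x * w y * k (f x) (f y) = w y * w x * k (f y) (f x)"
    by (simp only: psd_kernelD(1)[OF assms, of "f x" "f y"] mult.commute[of "w x" "w y"])
qed

lemma quad_inner:
  fixes v :: "nat \<Rightarrow> 'a::real_inner"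
  shows "(\<Sum>i<n. \<Sum>j<n. c i * c j * (v i \<bullet> v j)) = (norm (\<Sum>i<n. c i *\<^sub>R v i))\<^sup>2"
  by (simp add: power2_norm_eq_inner inner_sum_left inner_sum_right inner_commute mult_ac sum_distrib_left)

lemma psd_kernel_inner: "psd_kernel (\<bullet>)"
  unfolding psd_kernel_def by (simp add: quad_inner inner_commute)

lemma psd_kernel_const: "0 \<le> r \<Longrightarrow> psd_kernel (\<lambda>_ _. r)"
  unfolding psd_kernel_def
  using quad_inner[where v = "\<lambda>_. 1::real"]
  by (auto simp flip: sum_distrib_right)

section \<open>The Hilbert space of tensors over a real inner product space\<close>

fun word_inner :: "'a::real_inner list \<Rightarrow> 'a list \<Rightarrow> real" where
  "word_inner [] [] = 1"
| "word_inner (x # xs) (y # ys) = (x \<bullet> y) * word_inner xs ys"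
| "word_inner _ _ = 0"

lemma word_inner_eq:
  "word_inner xs ys = (if length xs = length ys then \<Prod>i<length xs. xs ! i \<bullet> ys ! i else 0)"
  by (induction xs ys rule: word_inner.induct) (simp_all add: prod.lessThan_Suc_shift del: prod.lessThan_Suc)

lemma word_inner_commute: "word_inner xs ys = word_inner ys xs"
  by (induction xs ys rule: word_inner.induct) (auto simp: inner_commute)

definition deg :: "nat \<Rightarrow> 'a list \<Rightarrow> real" where
  "deg d xs = (if length xs = d then 1 else 0)"

lemma psd_kernel_deg:
  "psd_kernel (\<lambda>xs ys :: 'a::real_inner list. deg d xs * deg d ys * word_inner xs ys)"
proof (induction d)
  case 0
  have "(\<lambda>xs ys :: 'a list. deg 0 xs * deg 0 ys * word_inner xs ys) = (\<lambda>xs ys. deg 0 xs * deg 0 ys * 1)"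
    by (auto simp: deg_def fun_eq_iff)
  then show ?case using psd_kernel_weight[OF psd_kernel_const[of 1], of "deg 0"] by simp
next
  case (Suc d)
  have eq: "deg (Suc d) xs * deg (Suc d) ys * word_inner xs ys =
      (deg (Suc d) xs * deg (Suc d) ys * (hd xs \<bullet> hd ys)) *
      (1 * 1 * (deg d (tl xs) * deg d (tl ys) * word_inner (tl xs) (tl ys)))" for xs ys :: "'a list"
    by (cases xs; cases ys) (auto simp: deg_def)
  show ?case
    unfolding eq
    by (intro psd_kernel_mult psd_kernel_weight[OF psd_kernel_inner, of _ hd]
          psd_kernel_weight[OF Suc, of "\<lambda>_. 1" tl])
qed

lemma psd_kernel_word_inner: "psd_kernel (word_inner :: 'a::real_inner list \<Rightarrow> _)"
  unfolding psd_kernel_def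
proof (intro conjI allI)
  fix n :: nat and x :: "nat \<Rightarrow> 'a list" and c :: "nat \<Rightarrow> real"
  define N where "N = (\<Sum>i<n. length (x i))"
  have len: "length (x i) \<le> N" if "i < n" for i
    unfolding N_def using that by (intro member_le_sum) auto
  have "word_inner (x i) (x j) = (\<Sum>d\<le>N. deg d (x i) * deg d (x j) * word_inner (x i) (x j))"
    if "i < n" "j < n" for i j
  proof -
    have "(\<Sum>d\<le>N. deg d (x i) * deg d (x j) * word_inner (x i) (x j))
        = (\<Sum>d\<le>N. if d = length (x i) then word_inner (x i) (x j) else 0)"
      by (intro sum.cong refl) (auto simp: deg_def word_inner_eq)
    then show ?thesis using len[OF that(1)] by simp
  qed
  then have "(\<Sum>i<n. \<Sum>j<n. c i * c j * word_inner (x i) (x j))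
     = (\<Sum>i<n. \<Sum>j<n. \<Sum>d\<le>N. c i * c j * (deg d (x i) * deg d (x j) * word_inner (x i) (x j)))"
    unfolding sum_distrib_left[symmetric] by (intro sum.cong refl) (metis lessThan_iff)
  also have "\<dots> = (\<Sum>i<n. \<Sum>d\<le>N. \<Sum>j<n. c i * c j * (deg d (x i) * deg d (x j) * word_inner (x i) (x j)))"
    by (intro sum.cong refl sum.swap)
  also have "\<dots> = (\<Sum>d\<le>N. \<Sum>i<n. \<Sum>j<n. c i * c j * (deg d (x i) * deg d (x j) * word_inner (x i) (x j)))"
    by (rule sum.swap)
  also have "\<dots> \<ge> 0"
    by (intro sum_nonneg psd_kernelD(2)[OF psd_kernel_deg])
  finally show "0 \<le> (\<Sum>i<n. \<Sum>j<n. c i * c j * word_inner (x i) (x j))" .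
qed (rule word_inner_commute)

text \<open>
  A finite list of pairs (coefficient, word) stands for a formal linear combination of elementary
  tensors; \<open>fext \<phi>\<close> is the linear extension of \<open>\<phi>\<close> to such combinations.
\<close>

type_synonym 'a fsum = "(real \<times> 'a list) list"

definition fext :: "('a list \<Rightarrow> 'b::real_vector) \<Rightarrow> 'a fsum \<Rightarrow> 'b" where
  "fext \<phi> u = (\<Sum>(a, xs)\<leftarrow>u. a *\<^sub>R \<phi> xs)"

definition fscale :: "real \<Rightarrow> 'a fsum \<Rightarrow> 'a fsum" where
  "fscale r u = map (\<lambda>(a, xs). (r * a, xs)) u"

definition finner :: "'a::real_inner fsum \<Rightarrow> 'a fsum \<Rightarrow> real" where
  "finner u v = fext (\<lambda>xs. fext (word_inner xs) v) u"

definition fnorm :: "'a::real_inner fsum \<Rightarrow> real" where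
  "fnorm u = sqrt (finner u u)"

definition fdiff :: "'a fsum \<Rightarrow> 'a fsum \<Rightarrow> 'a fsum" where
  "fdiff u v = u @ fscale (- 1) v"

lemma fext_simps [simp]:
  "fext \<phi> [] = 0"
  "fext \<phi> ((a, xs) # u) = a *\<^sub>R \<phi> xs + fext \<phi> u"
  "fext \<phi> (u @ v) = fext \<phi> u + fext \<phi> v"
  by (simp_all add: fext_def)

lemma fext_fscale [simp]: "fext \<phi> (fscale r u) = r *\<^sub>R fext \<phi> u"
  by (induction u) (auto simp: fscale_def fext_def scaleR_add_right)

lemma fext_add: "fext (\<lambda>xs. \<phi> xs + \<psi> xs) u = fext \<phi> u + fext \<psi> u"
  by (induction u) (auto simp: scaleR_add_right)

lemma fext_scale: "fext (\<lambda>xs. r *\<^sub>R \<phi> xs) u = r *\<^sub>R fext \<phi> u"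
  by (induction u) (auto simp: scaleR_add_right)

lemma fext_diff: "fext (\<lambda>xs. \<phi> xs - \<psi> xs) u = fext \<phi> u - fext \<psi> u"
  by (induction u) (auto simp: scaleR_diff_right)

lemma fext_mult: "fext (\<lambda>xs. r * \<phi> xs :: real) u = r * fext \<phi> u"
  using fext_scale[of r \<phi> u] by simp

lemma fext_0: "fext (\<lambda>xs. 0) u = 0"
  by (induction u) auto

lemma fext_linear: "linear T \<Longrightarrow> T (fext \<phi> u) = fext (\<lambda>xs. T (\<phi> xs)) u"
  by (induction u) (auto simp: linear_0 linear_add linear_scale)

lemma fext_swap: "fext (\<lambda>xs. fext (\<phi> xs) v) u = fext (\<lambda>ys. fext (\<lambda>xs. \<phi> xs ys) u) v"
proof (induction u)
  case (Cons p u)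
  then show ?case by (cases p) (simp add: fext_add fext_scale)
qed (simp add: fext_0)

lemma fext_nth: "fext \<phi> u = (\<Sum>i<length u. fst (u ! i) *\<^sub>R \<phi> (snd (u ! i)))"
  unfolding fext_def by (simp add: sum_list_sum_nth case_prod_unfold atLeast0LessThan)

lemma finner_simps [simp]:
  "finner [] v = 0" "finner u [] = 0"
  "finner (u @ u') v = finner u v + finner u' v"
  "finner u (v @ v') = finner u v + finner u v'"
  "finner (fscale r u) v = r * finner u v"
  "finner u (fscale r v) = r * finner u v"
  using fext_scale[where 'a = real]
  by (simp_all add: finner_def fext_add fext_0)

lemma finner_commute: "finner u v = finner v u"
  unfolding finner_def by (subst fext_swap) (simp add: word_inner_commute)

lemma psd_kernel_fext:
  assumes "psd_kernel k"
  shows "0 \<le> fext (\<lambda>xs. fext (k xs) u) u"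
  using psd_kernelD(2)[OF assms, where n = "length u" and c = "\<lambda>i. fst (u ! i)" and z = "\<lambda>i. snd (u ! i)"]
  by (simp add: fext_nth sum_distrib_left mult_ac)

lemma finner_ge_0 [simp]: "0 \<le> finner u u"
  unfolding finner_def by (rule psd_kernel_fext[OF psd_kernel_word_inner])

lemma fnorm_ge_0 [simp]: "0 \<le> fnorm u" by (simp add: fnorm_def)

lemma fnorm_sq: "(fnorm u)\<^sup>2 = finner u u" by (simp add: fnorm_def)

lemma finner_cs: "\<bar>finner u v\<bar> \<le> fnorm u * fnorm v"
proof -
  have "(finner u v)\<^sup>2 \<le> finner u u * finner v v"
  proof -
    have q: "0 \<le> finner u u + 2 * t * finner u v + t\<^sup>2 * finner v v" for t
      using finner_ge_0[of "u @ fscale t v"] finner_commute[of u v]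
      by (simp add: algebra_simps power2_eq_square del: finner_ge_0)
    show ?thesis
    proof (cases "finner v v = 0")
      case True
      have "finner u v = 0"
      proof (rule ccontr)
        assume "finner u v \<noteq> 0"
        then show False using q[of "(- finner u u - 1) / (2 * finner u v)"] True by (simp add: field_simps)
      qed
      then show ?thesis using True by simp
    next
      case False
      then have pos: "finner v v > 0" using finner_ge_0[of v] by linarith
      from q[of "- finner u v / finner v v"] pos
      show ?thesis by (simp add: field_simps power2_eq_square)
    qed
  qed
  then have "sqrt ((finner u v)\<^sup>2) \<le> sqrt (finner u u * finner v v)"
    by (rule real_sqrt_le_mono)
  then show ?thesis by (simp add: fnorm_def real_sqrt_mult)
qed

lemma fnorm_append: "fnorm (u @ v) \<le> fnorm u + fnorm v"
proof (rule power2_le_imp_le)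
  have "(fnorm (u @ v))\<^sup>2 = (fnorm u)\<^sup>2 + 2 * finner u v + (fnorm v)\<^sup>2"
    using finner_commute[of u v] by (simp add: fnorm_sq)
  also have "\<dots> \<le> (fnorm u + fnorm v)\<^sup>2"
    using finner_cs[of u v] by (simp add: power2_sum)
  finally show "(fnorm (u @ v))\<^sup>2 \<le> (fnorm u + fnorm v)\<^sup>2" .
qed simp

lemma fnorm_fscale [simp]: "fnorm (fscale r u) = \<bar>r\<bar> * fnorm u"
  by (simp add: fnorm_def real_sqrt_mult flip: mult.assoc)

lemma fnorm_cong:
  assumes "\<And>w. finner u w = finner v w" shows "fnorm u = fnorm v"
  unfolding fnorm_def using assms finner_commute by metis

lemma fdiff_triangle: "fnorm (fdiff u w) \<le> fnorm (fdiff u v) + fnorm (fdiff v w)"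
proof -
  have "fnorm (fdiff u w) = fnorm (fdiff u v @ fdiff v w)"
    by (rule fnorm_cong) (simp add: fdiff_def)
  then show ?thesis using fnorm_append by metis
qed

lemma fdiff_sym: "fnorm (fdiff u v) = fnorm (fdiff v u)"
proof -
  have "fnorm (fdiff u v) = fnorm (fscale (- 1) (fdiff v u))"
    by (rule fnorm_cong) (simp add: fdiff_def)
  then show ?thesis by simp
qed

lemma fdiff_self [simp]: "fnorm (fdiff u u) = 0"
  by (simp add: fnorm_def fdiff_def)

lemma fnorm_le_fdiff: "fnorm u \<le> fnorm (fdiff u v) + fnorm v"
proof -
  have "fnorm u = fnorm (fdiff u v @ v)"
    by (rule fnorm_cong) (simp add: fdiff_def)
  then show ?thesis using fnorm_append by metis
qed

lemma fdiff_append: "fnorm (fdiff (u @ v) (u' @ v')) \<le> fnorm (fdiff u u') + fnorm (fdiff v v')"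
proof -
  have "fnorm (fdiff (u @ v) (u' @ v')) = fnorm (fdiff u u' @ fdiff v v')"
    by (rule fnorm_cong) (simp add: fdiff_def)
  then show ?thesis using fnorm_append by metis
qed

lemma fdiff_fscale: "fnorm (fdiff (fscale r u) (fscale r v)) = \<bar>r\<bar> * fnorm (fdiff u v)"
proof -
  have "fnorm (fdiff (fscale r u) (fscale r v)) = fnorm (fscale r (fdiff u v))"
    by (rule fnorm_cong) (simp add: fdiff_def algebra_simps)
  then show ?thesis by simp
qed

lemma finner_diff:
  "\<bar>finner u v - finner u' v'\<bar> \<le> fnorm (fdiff u u') * fnorm v + fnorm u' * fnorm (fdiff v v')"
proof -
  have "finner u v - finner u' v' = finner (fdiff u u') v + finner u' (fdiff v v')"
    by (simp add: fdiff_def)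
  then show ?thesis
    using finner_cs[of "fdiff u u'" v] finner_cs[of u' "fdiff v v'"] by linarith
qed

definition fcauchy :: "(nat \<Rightarrow> 'a::real_inner fsum) \<Rightarrow> bool" where
  "fcauchy X \<longleftrightarrow> (\<forall>e>0. \<exists>N. \<forall>m\<ge>N. \<forall>n\<ge>N. fnorm (fdiff (X m) (X n)) < e)"

definition frel :: "(nat \<Rightarrow> 'a::real_inner fsum) \<Rightarrow> (nat \<Rightarrow> 'a fsum) \<Rightarrow> bool" where
  "frel X Y \<longleftrightarrow> fcauchy X \<and> fcauchy Y \<and> (\<lambda>n. fnorm (fdiff (X n) (Y n))) \<longlonglongrightarrow> 0"

lemma fcauchy_const [simp]: "fcauchy (\<lambda>_. u)"
  by (simp add: fcauchy_def)

lemma fcauchy_append: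
  assumes "fcauchy X" "fcauchy Y" shows "fcauchy (\<lambda>n. X n @ Y n)"
  unfolding fcauchy_def
proof (intro allI impI)
  fix e :: real assume "e > 0"
  then have "e / 2 > 0" by simp
  obtain M where M: "\<And>m n. m \<ge> M \<Longrightarrow> n \<ge> M \<Longrightarrow> fnorm (fdiff (X m) (X n)) < e / 2"
    using assms(1) \<open>e / 2 > 0\<close> unfolding fcauchy_def by blast
  obtain N where N: "\<And>m n. m \<ge> N \<Longrightarrow> n \<ge> N \<Longrightarrow> fnorm (fdiff (Y m) (Y n)) < e / 2"
    using assms(2) \<open>e / 2 > 0\<close> unfolding fcauchy_def by blast
  show "\<exists>N. \<forall>m\<ge>N. \<forall>n\<ge>N. fnorm (fdiff (X m @ Y m) (X n @ Y n)) < e"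
  proof (intro exI allI impI)
    fix m n assume "m \<ge> max M N" "n \<ge> max M N"
    then show "fnorm (fdiff (X m @ Y m) (X n @ Y n)) < e"
      using M[of m n] N[of m n] fdiff_append[of "X m" "Y m" "X n" "Y n"] by simp
  qed
qed

lemma fcauchy_fscale:
  assumes "fcauchy X" shows "fcauchy (\<lambda>n. fscale r (X n))"
  unfolding fcauchy_def
proof (intro allI impI)
  fix e :: real assume "e > 0"
  then have "e / (\<bar>r\<bar> + 1) > 0" by simp
  then obtain M where M: "\<And>m n. m \<ge> M \<Longrightarrow> n \<ge> M \<Longrightarrow> fnorm (fdiff (X m) (X n)) < e / (\<bar>r\<bar> + 1)"
    using assms(1) unfolding fcauchy_def by blast
  show "\<exists>N. \<forall>m\<ge>N. \<forall>n\<ge>N. fnorm (fdiff (fscale r (X m)) (fscale r (X n))) < e"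
  proof (intro exI allI impI)
    fix m n assume "m \<ge> M" "n \<ge> M"
    have "\<bar>r\<bar> * fnorm (fdiff (X m) (X n)) \<le> (\<bar>r\<bar> + 1) * fnorm (fdiff (X m) (X n))"
      by (intro mult_right_mono) auto
    also have "\<dots> < e" using M[OF \<open>m \<ge> M\<close> \<open>n \<ge> M\<close>] by (simp add: field_simps)
    finally show "fnorm (fdiff (fscale r (X m)) (fscale r (X n))) < e"
      by (simp add: fdiff_fscale)
  qed
qed

lemma fcauchy_bounded:
  assumes "fcauchy X" obtains B where "B > 0" "\<And>n. fnorm (X n) \<le> B"
proof -
  obtain N where N: "\<And>m n. m \<ge> N \<Longrightarrow> n \<ge> N \<Longrightarrow> fnorm (fdiff (X m) (X n)) < 1"
    using assms unfolding fcauchy_def by (meson zero_less_one)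
  define B where "B = 1 + (\<Sum>i\<le>N. fnorm (X i))"
  have le: "fnorm (X i) \<le> (\<Sum>i\<le>N. fnorm (X i))" if "i \<le> N" for i
    using that by (intro member_le_sum) auto
  have "fnorm (X n) \<le> B" for n
  proof (cases "n \<le> N")
    case False
    then show ?thesis
      using N[of n N] fnorm_le_fdiff[of "X n" "X N"] le[of N] by (simp add: B_def)
  qed (use le[of n] in \<open>simp add: B_def\<close>)
  moreover have "B > 0" unfolding B_def by (simp add: add_pos_nonneg sum_nonneg)
  ultimately show ?thesis using that by blast
qed

lemma finner_frel:
  assumes "frel X X'" "frel Y Y'"
  shows "(\<lambda>n. finner (X n) (Y n) - finner (X' n) (Y' n)) \<longlonglongrightarrow> 0"
proof -
  obtain B where B: "\<And>n. fnorm (Y n) \<le> B"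
    using assms fcauchy_bounded unfolding frel_def by metis
  obtain C where C: "\<And>n. fnorm (X' n) \<le> C"
    using assms fcauchy_bounded unfolding frel_def by metis
  show ?thesis
  proof (rule Lim_null_comparison)
    show "\<forall>\<^sub>F n in sequentially. norm (finner (X n) (Y n) - finner (X' n) (Y' n))
        \<le> fnorm (fdiff (X n) (X' n)) * B + C * fnorm (fdiff (Y n) (Y' n))"
    proof (intro always_eventually allI)
      fix n
      have "fnorm (fdiff (X n) (X' n)) * fnorm (Y n) \<le> fnorm (fdiff (X n) (X' n)) * B"
        using B by (intro mult_left_mono) auto
      moreover have "fnorm (X' n) * fnorm (fdiff (Y n) (Y' n)) \<le> C * fnorm (fdiff (Y n) (Y' n))"
        using C by (intro mult_right_mono) auto
      ultimately show "norm (finner (X n) (Y n) - finner (X' n) (Y' n))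
          \<le> fnorm (fdiff (X n) (X' n)) * B + C * fnorm (fdiff (Y n) (Y' n))"
        using finner_diff[of "X n" "Y n" "X' n" "Y' n"] by simp
    qed
    show "(\<lambda>n. fnorm (fdiff (X n) (X' n)) * B + C * fnorm (fdiff (Y n) (Y' n))) \<longlonglongrightarrow> 0"
      using assms unfolding frel_def by (auto intro!: tendsto_eq_intros)
  qed
qed

lemma finner_convergent:
  assumes "fcauchy X" "fcauchy Y"
  shows "convergent (\<lambda>n. finner (X n) (Y n))"
proof -
  obtain B where B: "B > 0" "\<And>n. fnorm (Y n) \<le> B"
    using assms fcauchy_bounded by metis
  obtain C where C: "C > 0" "\<And>n. fnorm (X n) \<le> C"
    using assms fcauchy_bounded by metis
  have "Cauchy (\<lambda>n. finner (X n) (Y n))"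
  proof (rule metric_CauchyI)
    fix e :: real assume e: "e > 0"
    have "e / (2 * B) > 0" "e / (2 * C) > 0" using e B C by auto
    obtain M where M: "\<And>m n. m \<ge> M \<Longrightarrow> n \<ge> M \<Longrightarrow> fnorm (fdiff (X m) (X n)) < e / (2 * B)"
      using assms(1) \<open>e / (2 * B) > 0\<close> unfolding fcauchy_def by blast
    obtain N where N: "\<And>m n. m \<ge> N \<Longrightarrow> n \<ge> N \<Longrightarrow> fnorm (fdiff (Y m) (Y n)) < e / (2 * C)"
      using assms(2) \<open>e / (2 * C) > 0\<close> unfolding fcauchy_def by blast
    show "\<exists>N. \<forall>m\<ge>N. \<forall>n\<ge>N. dist (finner (X m) (Y m)) (finner (X n) (Y n)) < e"
    proof (intro exI allI impI)
      fix m n assume "m \<ge> max M N" "n \<ge> max M N"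
      then have m: "fnorm (fdiff (X m) (X n)) < e / (2 * B)" "fnorm (fdiff (Y m) (Y n)) < e / (2 * C)"
        using M N by auto
      have "fnorm (fdiff (X m) (X n)) * fnorm (Y m) \<le> fnorm (fdiff (X m) (X n)) * B"
        using B by (intro mult_left_mono) auto
      also have "\<dots> < e / 2" using m(1) B by (simp add: field_simps)
      finally have 1: "fnorm (fdiff (X m) (X n)) * fnorm (Y m) < e / 2" .
      have "fnorm (X n) * fnorm (fdiff (Y m) (Y n)) \<le> C * fnorm (fdiff (Y m) (Y n))"
        using C by (intro mult_right_mono) auto
      also have "\<dots> < e / 2" using m(2) C by (simp add: field_simps)
      finally show "dist (finner (X m) (Y m)) (finner (X n) (Y n)) < e"
        using 1 finner_diff[of "X m" "Y m" "X n" "Y n"] by (simp add: dist_real_def)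
    qed
  qed
  then show ?thesis by (simp add: Cauchy_convergent_iff)
qed

lemma part_equivp_frel:
  "part_equivp (frel :: (nat \<Rightarrow> 'a::real_inner fsum) \<Rightarrow> (nat \<Rightarrow> 'a fsum) \<Rightarrow> bool)"
proof (rule part_equivpI)
  show "\<exists>X :: nat \<Rightarrow> 'a fsum. frel X X"
    by (rule exI[of _ "\<lambda>_. []"]) (simp add: frel_def)
  show "symp (frel :: (nat \<Rightarrow> 'a fsum) \<Rightarrow> _)"
    unfolding symp_def frel_def by (simp add: fdiff_sym)
  show "transp (frel :: (nat \<Rightarrow> 'a fsum) \<Rightarrow> _)"
    unfolding transp_def
  proof (intro allI impI)
    fix X Y Z :: "nat \<Rightarrow> 'a fsum" assume *: "frel X Y" "frel Y Z"
    have "(\<lambda>n. fnorm (fdiff (X n) (Z n))) \<longlonglongrightarrow> 0"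
    proof (rule Lim_null_comparison)
      show "\<forall>\<^sub>F n in sequentially. norm (fnorm (fdiff (X n) (Z n)))
          \<le> fnorm (fdiff (X n) (Y n)) + fnorm (fdiff (Y n) (Z n))"
        by (simp add: fdiff_triangle)
      show "(\<lambda>n. fnorm (fdiff (X n) (Y n)) + fnorm (fdiff (Y n) (Z n))) \<longlonglongrightarrow> 0"
        using * unfolding frel_def by (auto intro!: tendsto_eq_intros)
    qed
    then show "frel X Z" using * by (simp add: frel_def)
  qed
qed

text \<open>
  \<open>'a fock\<close> is the full Fock space of \<open>'a\<close>: the completion of the space of formal combinations of
  elementary tensors with respect to the inner product determined by \<open>word_inner\<close> on words, that is,
  the Hilbert space direct sum of all tensor powers of \<open>'a\<close>.  Collecting all degrees in one type
  makes the degree an ordinary parameter; the individual tensor powers are closed subspaces of it.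
\<close>

quotient_type (overloaded) 'a fock = "nat \<Rightarrow> 'a::real_inner fsum" / partial: frel
  by (rule part_equivp_frel)

instantiation fock :: (real_inner) real_inner
begin

lift_definition zero_fock :: "'a fock" is "\<lambda>_. []" by (simp add: frel_def)

lift_definition plus_fock :: "'a fock \<Rightarrow> 'a fock \<Rightarrow> 'a fock" is "\<lambda>X Y n. X n @ Y n"
proof -
  fix X X' Y Y' :: "nat \<Rightarrow> 'a fsum" assume *: "frel X X'" "frel Y Y'"
  have "(\<lambda>n. fnorm (fdiff (X n @ Y n) (X' n @ Y' n))) \<longlonglongrightarrow> 0"
  proof (rule Lim_null_comparison)
    show "\<forall>\<^sub>F n in sequentially. norm (fnorm (fdiff (X n @ Y n) (X' n @ Y' n)))
        \<le> fnorm (fdiff (X n) (X' n)) + fnorm (fdiff (Y n) (Y' n))"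
      by (simp add: fdiff_append)
    show "(\<lambda>n. fnorm (fdiff (X n) (X' n)) + fnorm (fdiff (Y n) (Y' n))) \<longlonglongrightarrow> 0"
      using * unfolding frel_def by (auto intro!: tendsto_eq_intros)
  qed
  then show "frel (\<lambda>n. X n @ Y n) (\<lambda>n. X' n @ Y' n)"
    using * by (simp add: frel_def fcauchy_append)
qed

lift_definition scaleR_fock :: "real \<Rightarrow> 'a fock \<Rightarrow> 'a fock" is "\<lambda>r X n. fscale r (X n)"
proof -
  fix r :: real and X Y :: "nat \<Rightarrow> 'a fsum" assume *: "frel X Y"
  then have "(\<lambda>n. \<bar>r\<bar> * fnorm (fdiff (X n) (Y n))) \<longlonglongrightarrow> 0"
    unfolding frel_def by (intro tendsto_mult_right_zero) blast
  then show "frel (\<lambda>n. fscale r (X n)) (\<lambda>n. fscale r (Y n))"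
    using * by (simp add: frel_def fcauchy_fscale fdiff_fscale)
qed

definition uminus_fock :: "'a fock \<Rightarrow> 'a fock" where "uminus_fock x = (- 1) *\<^sub>R x"

definition minus_fock :: "'a fock \<Rightarrow> 'a fock \<Rightarrow> 'a fock" where "minus_fock x y = x + (- 1) *\<^sub>R y"

lift_definition inner_fock :: "'a fock \<Rightarrow> 'a fock \<Rightarrow> real" is "\<lambda>X Y. lim (\<lambda>n. finner (X n) (Y n))"
proof -
  fix X X' Y Y' :: "nat \<Rightarrow> 'a fsum" assume *: "frel X X'" "frel Y Y'"
  then have "fcauchy X" "fcauchy X'" "fcauchy Y" "fcauchy Y'" by (auto simp: frel_def)
  then have "(\<lambda>n. finner (X n) (Y n)) \<longlonglongrightarrow> lim (\<lambda>n. finner (X n) (Y n))"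
    "(\<lambda>n. finner (X' n) (Y' n)) \<longlonglongrightarrow> lim (\<lambda>n. finner (X' n) (Y' n))"
    using finner_convergent convergent_LIMSEQ_iff by blast+
  then have "(\<lambda>n. finner (X n) (Y n) - finner (X' n) (Y' n)) \<longlonglongrightarrow>
     lim (\<lambda>n. finner (X n) (Y n)) - lim (\<lambda>n. finner (X' n) (Y' n))"
    by (rule tendsto_diff)
  from LIMSEQ_unique[OF this finner_frel[OF *]]
  show "lim (\<lambda>n. finner (X n) (Y n)) = lim (\<lambda>n. finner (X' n) (Y' n))" by simp
qed

definition norm_fock :: "'a fock \<Rightarrow> real" where "norm_fock x = sqrt (inner x x)"

definition sgn_fock :: "'a fock \<Rightarrow> 'a fock" where "sgn_fock x = inverse (norm x) *\<^sub>R x"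

definition dist_fock :: "'a fock \<Rightarrow> 'a fock \<Rightarrow> real" where "dist_fock x y = norm (x - y)"

definition uniformity_fock :: "('a fock \<times> 'a fock) filter" where
  "uniformity_fock = (INF e\<in>{0<..}. principal {(x, y). dist x y < e})"

definition open_fock :: "'a fock set \<Rightarrow> bool" where
  "open_fock U \<longleftrightarrow> (\<forall>x\<in>U. eventually (\<lambda>(x', y). x' = x \<longrightarrow> y \<in> U) uniformity)"

lemma frelI:
  assumes "fcauchy X" "fcauchy Y" "\<And>n w. finner (X n) w = finner (Y n) w"
  shows "frel X Y"
proof -
  have "fnorm (fdiff (X n) (Y n)) = 0" for n
    unfolding fnorm_def fdiff_def by (simp add: assms(3))
  then show ?thesis using assms(1,2) by (simp add: frel_def)
qed

lemma finner_lim: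
  assumes "fcauchy X" "fcauchy Y"
  shows "(\<lambda>n. finner (X n) (Y n)) \<longlonglongrightarrow> lim (\<lambda>n. finner (X n) (Y n))"
  using finner_convergent[OF assms] convergent_LIMSEQ_iff by blast

instance
proof
  fix x y z :: "'a fock" and a b :: real
  note rule = frelI fcauchy_append fcauchy_fscale fcauchy_const
  show "x + y + z = x + (y + z)"
    by transfer (intro rule; simp add: frel_def algebra_simps)
  show "x + y = y + x"
    by transfer (intro rule; simp add: frel_def algebra_simps)
  show "0 + x = x"
    by transfer (intro rule; simp add: frel_def algebra_simps)
  show "- x + x = 0"
    unfolding uminus_fock_def
    by transfer (intro rule; simp add: frel_def algebra_simps)
  show "x - y = x + - y" by (simp add: minus_fock_def uminus_fock_def)
  show "a *\<^sub>R (x + y) = a *\<^sub>R x + a *\<^sub>R y"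
    by transfer (intro rule; simp add: frel_def algebra_simps)
  show "(a + b) *\<^sub>R x = a *\<^sub>R x + b *\<^sub>R x"
    by transfer (intro rule; simp add: frel_def algebra_simps)
  show "a *\<^sub>R b *\<^sub>R x = (a * b) *\<^sub>R x"
    by transfer (intro rule; simp add: frel_def algebra_simps)
  show "1 *\<^sub>R x = x"
    by transfer (intro rule; simp add: frel_def algebra_simps)
  show "inner x y = inner y x"
    by transfer (simp add: finner_commute)
  show "inner (x + y) z = inner x z + inner y z"
  proof transfer
    fix X Y Z :: "nat \<Rightarrow> 'a fsum" assume "frel X X" "frel Y Y" "frel Z Z"
    then have "(\<lambda>n. finner (X n) (Z n) + finner (Y n) (Z n)) \<longlonglongrightarrow>
        lim (\<lambda>n. finner (X n) (Z n)) + lim (\<lambda>n. finner (Y n) (Z n))"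
      by (intro tendsto_add finner_lim) (auto simp: frel_def)
    then show "lim (\<lambda>n. finner (X n @ Y n) (Z n)) = lim (\<lambda>n. finner (X n) (Z n)) + lim (\<lambda>n. finner (Y n) (Z n))"
      by (simp add: limI)
  qed
  show "inner (a *\<^sub>R x) y = a * inner x y"
  proof transfer
    fix a :: real and X Y :: "nat \<Rightarrow> 'a fsum" assume "frel X X" "frel Y Y"
    then have "(\<lambda>n. a * finner (X n) (Y n)) \<longlonglongrightarrow> a * lim (\<lambda>n. finner (X n) (Y n))"
      by (intro tendsto_mult tendsto_const finner_lim) (auto simp: frel_def)
    then show "lim (\<lambda>n. finner (fscale a (X n)) (Y n)) = a * lim (\<lambda>n. finner (X n) (Y n))"
      by (simp add: limI)
  qed
  show "0 \<le> inner x x"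
  proof transfer
    fix X :: "nat \<Rightarrow> 'a fsum" assume "frel X X"
    then have "(\<lambda>n. finner (X n) (X n)) \<longlonglongrightarrow> lim (\<lambda>n. finner (X n) (X n))"
      by (intro finner_lim) (auto simp: frel_def)
    then show "0 \<le> lim (\<lambda>n. finner (X n) (X n))"
      by (rule LIMSEQ_le_const) auto
  qed
  show "inner x x = 0 \<longleftrightarrow> x = 0"
  proof transfer
    fix X :: "nat \<Rightarrow> 'a fsum" assume X: "frel X X"
    then have l: "(\<lambda>n. finner (X n) (X n)) \<longlonglongrightarrow> lim (\<lambda>n. finner (X n) (X n))"
      by (intro finner_lim) (auto simp: frel_def)
    have eq: "fnorm (fdiff (X n) []) = fnorm (X n)" for n
      by (rule fnorm_cong) (simp add: fdiff_def)
    have "frel X (\<lambda>_. []) \<longleftrightarrow> (\<lambda>n. fnorm (X n)) \<longlonglongrightarrow> 0"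
      using X by (simp add: frel_def eq)
    also have "\<dots> \<longleftrightarrow> (\<lambda>n. finner (X n) (X n)) \<longlonglongrightarrow> 0"
    proof
      assume "(\<lambda>n. fnorm (X n)) \<longlonglongrightarrow> 0"
      from tendsto_power[OF this, of 2] show "(\<lambda>n. finner (X n) (X n)) \<longlonglongrightarrow> 0"
        by (simp add: fnorm_sq)
    next
      assume "(\<lambda>n. finner (X n) (X n)) \<longlonglongrightarrow> 0"
      from tendsto_real_sqrt[OF this] show "(\<lambda>n. fnorm (X n)) \<longlonglongrightarrow> 0"
        by (simp add: fnorm_def)
    qed
    also have "\<dots> \<longleftrightarrow> lim (\<lambda>n. finner (X n) (X n)) = 0"
      using l LIMSEQ_unique by metis
    finally show "(lim (\<lambda>n. finner (X n) (X n)) = 0) = frel X (\<lambda>_. [])" by simp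
  qed
  show "norm x = sqrt (inner x x)" by (rule norm_fock_def)
  show "dist x y = norm (x - y)" by (rule dist_fock_def)
  show "sgn x = inverse (norm x) *\<^sub>R x" by (rule sgn_fock_def)
  show "(uniformity :: ('a fock \<times> 'a fock) filter) = (INF e\<in>{0<..}. principal {(x, y). dist x y < e})"
    by (rule uniformity_fock_def)
  show "open U \<longleftrightarrow> (\<forall>x\<in>U. eventually (\<lambda>(x', y). x' = x \<longrightarrow> y \<in> U) uniformity)" for U :: "'a fock set"
    by (rule open_fock_def)
qed

end

lift_definition femb :: "'a::real_inner fsum \<Rightarrow> 'a fock" is "\<lambda>u _. u"
  by (simp add: frel_def)

definition tens :: "'a::real_inner list \<Rightarrow> 'a fock" where
  "tens xs = femb [(1, xs)]"

lemma femb_append: "femb (u @ v) = femb u + femb v"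
  by transfer (simp add: frel_def)

lemma femb_fscale: "femb (fscale r u) = r *\<^sub>R femb u"
  by transfer (simp add: frel_def)

lemma femb_Nil: "femb [] = 0"
  by transfer (simp add: frel_def)

lemma femb_eq: "femb u = fext tens u"
proof (induction u)
  case (Cons p u)
  obtain a xs where p: "p = (a, xs)" by (cases p)
  have "femb (p # u) = femb (fscale a [(1, xs)] @ u)" by (simp add: p fscale_def)
  then show ?case using Cons by (simp add: femb_append femb_fscale tens_def p)
qed (simp add: femb_Nil)

lemma inner_femb: "femb u \<bullet> femb v = finner u v"
  by transfer simp

lemma norm_femb: "norm (femb u) = fnorm u"
  by (simp add: norm_eq_sqrt_inner inner_femb fnorm_def)

lemma femb_fdiff: "femb (fdiff u v) = femb u - femb v"
  by (simp add: fdiff_def femb_append femb_fscale)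

lemma inner_tens: "tens xs \<bullet> tens ys = (if length xs = length ys then \<Prod>i<length xs. xs ! i \<bullet> ys ! i else 0)"
  by (simp add: tens_def inner_femb finner_def flip: word_inner_eq)

lemma abs_fock_lim:
  assumes "fcauchy X" shows "(\<lambda>n. femb (X n)) \<longlonglongrightarrow> abs_fock X"
proof -
  have dist_eq: "(\<lambda>n. finner (fdiff (X n) u) (fdiff (X n) u)) \<longlonglongrightarrow> (norm (abs_fock X - femb u))\<^sup>2" for u
  proof -
    have c: "fcauchy (\<lambda>n. fdiff (X n) u)"
      unfolding fdiff_def by (intro fcauchy_append assms fcauchy_const)
    have "abs_fock X - femb u = abs_fock (\<lambda>n. fdiff (X n) u)"
      using assms unfolding minus_fock_def fdiff_def
      by (simp add: femb.abs_eq scaleR_fock.abs_eq plus_fock.abs_eq frel_def fcauchy_fscale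
          del: scaleR_minus_left scaleR_minus1_left)
    then have "(norm (abs_fock X - femb u))\<^sup>2 = lim (\<lambda>n. finner (fdiff (X n) u) (fdiff (X n) u))"
      using c by (simp add: power2_norm_eq_inner inner_fock.abs_eq frel_def)
    then show ?thesis using finner_lim[OF c c] by simp
  qed
  show ?thesis
  proof (rule metric_LIMSEQ_I)
    fix e :: real assume "e > 0"
    then have "e / 2 > 0" by simp
    then obtain N where N: "\<And>m n. m \<ge> N \<Longrightarrow> n \<ge> N \<Longrightarrow> fnorm (fdiff (X m) (X n)) < e / 2"
      using assms unfolding fcauchy_def by blast
    have "dist (femb (X n)) (abs_fock X) < e" if "n \<ge> N" for n
    proof -
      have "(norm (abs_fock X - femb (X n)))\<^sup>2 \<le> (e / 2)\<^sup>2"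
      proof (rule LIMSEQ_le_const2[OF dist_eq[of "X n"]], intro exI allI impI)
        fix m assume "m \<ge> N"
        show "finner (fdiff (X m) (X n)) (fdiff (X m) (X n)) \<le> (e / 2)\<^sup>2"
          unfolding fnorm_sq[symmetric]
          by (rule power_mono[OF less_imp_le[OF N[OF \<open>m \<ge> N\<close> that]]]) simp
      qed
      then have "norm (abs_fock X - femb (X n)) \<le> e / 2"
        by (rule power2_le_imp_le) (use \<open>e > 0\<close> in simp)
      then show ?thesis using \<open>e > 0\<close> by (simp add: dist_norm norm_minus_commute)
    qed
    then show "\<exists>N. \<forall>n\<ge>N. dist (femb (X n)) (abs_fock X) < e" by blast
  qed
qed

lemma femb_dense: obtains X where "fcauchy X" "(\<lambda>n. femb (X n)) \<longlonglongrightarrow> x"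
proof -
  obtain X where "frel X X" "abs_fock X = x"
    using Quotient_rep_reflp[OF Quotient_fock] Quotient_abs_rep[OF Quotient_fock] by blast
  then show ?thesis using that abs_fock_lim by (metis frel_def)
qed

instance fock :: (real_inner) complete_space
proof
  fix x :: "nat \<Rightarrow> 'a fock" assume C: "Cauchy x"
  have "\<exists>u. dist (x k) (femb u) < 1 / real (Suc k)" for k
  proof -
    obtain X where "(\<lambda>n. femb (X n)) \<longlonglongrightarrow> x k" using femb_dense by blast
    from metric_LIMSEQ_D[OF this, of "1 / real (Suc k)"]
    obtain n where "dist (femb (X n)) (x k) < 1 / real (Suc k)" by auto
    then show ?thesis by (metis dist_commute)
  qed
  then obtain u where u: "\<And>k. dist (x k) (femb (u k)) < 1 / real (Suc k)" by metis
  have lim0: "(\<lambda>k. 1 / real (Suc k)) \<longlonglongrightarrow> 0" by (rule LIMSEQ_Suc[OF lim_1_over_n])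
  have z: "(\<lambda>k. dist (x k) (femb (u k))) \<longlonglongrightarrow> 0"
    by (rule Lim_null_comparison[OF _ lim0]) (use u less_imp_le in \<open>auto intro!: always_eventually\<close>)
  have "fcauchy u"
    unfolding fcauchy_def
  proof (intro allI impI)
    fix e :: real assume "e > 0"
    then have e3: "e / 3 > 0" by simp
    obtain M where M: "\<And>m n. m \<ge> M \<Longrightarrow> n \<ge> M \<Longrightarrow> dist (x m) (x n) < e / 3"
      using metric_CauchyD[OF C e3] by blast
    obtain N where N: "\<And>n. n \<ge> N \<Longrightarrow> dist (x n) (femb (u n)) < e / 3"
      using metric_LIMSEQ_D[OF z e3] by (auto simp: dist_real_def)
    show "\<exists>N. \<forall>m\<ge>N. \<forall>n\<ge>N. fnorm (fdiff (u m) (u n)) < e"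
    proof (intro exI allI impI)
      fix m n assume "m \<ge> max M N" "n \<ge> max M N"
      then have "dist (x m) (x n) < e / 3" "dist (x n) (femb (u n)) < e / 3" "dist (x m) (femb (u m)) < e / 3"
        using M N by auto
      then have "dist (femb (u m)) (femb (u n)) < e"
        using dist_triangle[of "femb (u m)" "femb (u n)" "x m"] dist_triangle[of "x m" "femb (u n)" "x n"]
        by (simp add: dist_commute)
      then show "fnorm (fdiff (u m) (u n)) < e"
        by (simp add: dist_norm flip: norm_femb femb_fdiff)
    qed
  qed
  then have "(\<lambda>n. femb (u n)) \<longlonglongrightarrow> abs_fock u" by (rule abs_fock_lim)
  moreover have "(\<lambda>k. x k - femb (u k)) \<longlonglongrightarrow> 0"
    using z by (simp add: dist_norm tendsto_norm_zero_iff)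
  ultimately have "(\<lambda>k. (x k - femb (u k)) + femb (u k)) \<longlonglongrightarrow> 0 + abs_fock u"
    by (intro tendsto_add)
  then show "convergent x" by (auto simp: convergent_def)
qed

instance fock :: (real_inner) banach ..

lemma bounded_linear_fock_eqI:
  fixes T T' :: "'a::real_inner fock \<Rightarrow> 'b::real_normed_vector"
  assumes "bounded_linear T" "bounded_linear T'" "\<And>xs. T (tens xs) = T' (tens xs)"
  shows "T = T'"
proof
  fix x :: "'a fock"
  obtain X where X: "(\<lambda>n. femb (X n)) \<longlonglongrightarrow> x" using femb_dense by blast
  have eq: "T (femb u) = T' (femb u)" for u
    unfolding femb_eq fext_linear[OF bounded_linear.linear[OF assms(1)]]
      fext_linear[OF bounded_linear.linear[OF assms(2)]] assms(3) ..
  show "T x = T' x"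
    using LIMSEQ_unique[OF bounded_linear.tendsto[OF assms(1) X, unfolded eq]
        bounded_linear.tendsto[OF assms(2) X]] .
qed

lemma fock_extension:
  fixes \<phi> :: "'a::real_inner list \<Rightarrow> 'b::banach"
  assumes bound: "\<And>u. norm (fext \<phi> u) \<le> C * fnorm u"
  shows "\<exists>T. bounded_linear T \<and> (\<forall>xs. T (tens xs) = \<phi> xs)"
proof -
  have diff: "norm (fext \<phi> u - fext \<phi> v) \<le> C * dist (femb u) (femb v)" for u v
    using bound[of "fdiff u v"] by (simp add: dist_norm flip: norm_femb femb_fdiff) (simp add: fdiff_def)
  have C0: "\<bar>C\<bar> \<ge> C" by simp
  have ex: "\<exists>y. \<forall>X. (\<lambda>n. femb (X n)) \<longlonglongrightarrow> x \<longrightarrow> (\<lambda>n. fext \<phi> (X n)) \<longlonglongrightarrow> y" for x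
  proof -
    obtain X where X: "(\<lambda>n. femb (X n)) \<longlonglongrightarrow> x" using femb_dense by blast
    have "Cauchy (\<lambda>n. fext \<phi> (X n))"
    proof (rule metric_CauchyI)
      fix e :: real assume "e > 0"
      then have "e / (\<bar>C\<bar> + 1) > 0" by simp
      from metric_CauchyD[OF LIMSEQ_imp_Cauchy[OF X] this] obtain N where
        N: "\<And>m n. m \<ge> N \<Longrightarrow> n \<ge> N \<Longrightarrow> dist (femb (X m)) (femb (X n)) < e / (\<bar>C\<bar> + 1)" by blast
      show "\<exists>N. \<forall>m\<ge>N. \<forall>n\<ge>N. dist (fext \<phi> (X m)) (fext \<phi> (X n)) < e"
      proof (intro exI allI impI)
        fix m n assume mn: "m \<ge> N" "n \<ge> N"
        have "dist (fext \<phi> (X m)) (fext \<phi> (X n)) \<le> C * dist (femb (X m)) (femb (X n))"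
          using diff by (simp add: dist_norm)
        also have "\<dots> \<le> (\<bar>C\<bar> + 1) * dist (femb (X m)) (femb (X n))"
          by (intro mult_right_mono) auto
        also have "\<dots> < e" using N[OF mn] by (simp add: field_simps)
        finally show "dist (fext \<phi> (X m)) (fext \<phi> (X n)) < e" .
      qed
    qed
    then obtain y where y: "(\<lambda>n. fext \<phi> (X n)) \<longlonglongrightarrow> y"
      by (auto simp: Cauchy_convergent_iff convergent_def)
    show ?thesis
    proof (intro exI allI impI)
      fix Y assume Y: "(\<lambda>n. femb (Y n)) \<longlonglongrightarrow> x"
      have "(\<lambda>n. fext \<phi> (Y n) - fext \<phi> (X n)) \<longlonglongrightarrow> 0"
      proof (rule Lim_null_comparison)
        show "\<forall>\<^sub>F n in sequentially. norm (fext \<phi> (Y n) - fext \<phi> (X n)) \<le> C * dist (femb (Y n)) (femb (X n))"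
          using diff by simp
        show "(\<lambda>n. C * dist (femb (Y n)) (femb (X n))) \<longlonglongrightarrow> 0"
          using tendsto_mult[OF tendsto_const[of C] tendsto_dist[OF Y X]] by simp
      qed
      from tendsto_add[OF this y] show "(\<lambda>n. fext \<phi> (Y n)) \<longlonglongrightarrow> y" by simp
    qed
  qed
  then obtain T where T: "\<And>x X. (\<lambda>n. femb (X n)) \<longlonglongrightarrow> x \<Longrightarrow> (\<lambda>n. fext \<phi> (X n)) \<longlonglongrightarrow> T x"
    by metis
  have "bounded_linear T"
  proof (rule bounded_linear_intro[where K = C])
    fix x y :: "'a fock" and r :: real
    obtain X where X: "(\<lambda>n. femb (X n)) \<longlonglongrightarrow> x" using femb_dense by blast
    obtain Y where Y: "(\<lambda>n. femb (Y n)) \<longlonglongrightarrow> y" using femb_dense by blast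
    have "(\<lambda>n. femb (X n @ Y n)) \<longlonglongrightarrow> x + y"
      unfolding femb_append by (intro tendsto_add X Y)
    from T[OF this] have "(\<lambda>n. fext \<phi> (X n) + fext \<phi> (Y n)) \<longlonglongrightarrow> T (x + y)" by simp
    then show "T (x + y) = T x + T y"
      using LIMSEQ_unique tendsto_add[OF T[OF X] T[OF Y]] by blast
    have "(\<lambda>n. femb (fscale r (X n))) \<longlonglongrightarrow> r *\<^sub>R x"
      unfolding femb_fscale by (intro tendsto_intros X)
    from T[OF this] have "(\<lambda>n. r *\<^sub>R fext \<phi> (X n)) \<longlonglongrightarrow> T (r *\<^sub>R x)" by simp
    then show "T (r *\<^sub>R x) = r *\<^sub>R T x"
      using LIMSEQ_unique tendsto_scaleR[OF tendsto_const T[OF X]] by blast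
    have 1: "(\<lambda>n. norm (femb (X n)) * C) \<longlonglongrightarrow> norm x * C" by (intro tendsto_intros X)
    have 2: "(\<lambda>n. norm (fext \<phi> (X n))) \<longlonglongrightarrow> norm (T x)" by (intro tendsto_intros T X)
    show "norm (T x) \<le> norm x * C"
      by (rule LIMSEQ_le[OF 2 1]) (use bound in \<open>auto simp: norm_femb mult.commute\<close>)
  qed
  moreover have "T (tens xs) = \<phi> xs" for xs
  proof -
    have "(\<lambda>n::nat. femb [(1, xs)]) \<longlonglongrightarrow> tens xs" by (simp add: tens_def)
    from T[OF this] show ?thesis by (simp add: LIMSEQ_const_iff)
  qed
  ultimately show ?thesis by blast
qed

section \<open>Tensor powers of Hilbert spaces, operators and functionals\<close>

definition tensor_power :: "nat \<Rightarrow> 'a::real_inner fock set" where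
  "tensor_power d = closure (span (tens ` {xs. length xs = d}))"

text \<open>
  Operators on the \<open>d\<close>-th tensor power are represented by operators on the whole space that vanish
  on the other degrees; this determines them uniquely.
\<close>

definition tensor_power_op ::
  "nat \<Rightarrow> ('a::real_inner \<Rightarrow> 'b::real_inner) \<Rightarrow> 'a fock \<Rightarrow> 'b fock" where
  "tensor_power_op d S = (THE T. bounded_linear T \<and>
     (\<forall>xs. T (tens xs) = (if length xs = d then tens (map S xs) else 0)))"

definition tensor_power_functional ::
  "nat \<Rightarrow> ('a::real_inner \<Rightarrow> real) \<Rightarrow> 'a fock \<Rightarrow> real" where
  "tensor_power_functional d I = (THE T. bounded_linear T \<and>
     (\<forall>xs. T (tens xs) = (if length xs = d then \<Prod>x\<leftarrow>xs. I x else 0)))"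

lemma psd_kernel_op:
  fixes S :: "'a::real_inner \<Rightarrow> 'b::real_inner"
  assumes "linear S" "\<And>x. norm (S x) \<le> K * norm x"
  shows "psd_kernel (\<lambda>x y. K\<^sup>2 * (x \<bullet> y) - S x \<bullet> S y)"
  unfolding psd_kernel_def
proof (intro conjI allI)
  fix n :: nat and x :: "nat \<Rightarrow> 'a" and c :: "nat \<Rightarrow> real"
  have "(\<Sum>i<n. \<Sum>j<n. c i * c j * (K\<^sup>2 * (x i \<bullet> x j) - S (x i) \<bullet> S (x j)))
    = K\<^sup>2 * (\<Sum>i<n. \<Sum>j<n. c i * c j * (x i \<bullet> x j)) - (\<Sum>i<n. \<Sum>j<n. c i * c j * (S (x i) \<bullet> S (x j)))"
    by (simp add: algebra_simps sum_subtractf sum_distrib_left)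
  also have "\<dots> = (K * norm (\<Sum>i<n. c i *\<^sub>R x i))\<^sup>2 - (norm (S (\<Sum>i<n. c i *\<^sub>R x i)))\<^sup>2"
    unfolding quad_inner by (simp add: linear_sum[OF assms(1)] linear_scale[OF assms(1)] power_mult_distrib)
  also have "\<dots> \<ge> 0"
    using assms(2) by (simp add: power_mono)
  finally show "0 \<le> (\<Sum>i<n. \<Sum>j<n. c i * c j * (K\<^sup>2 * (x i \<bullet> x j) - S (x i) \<bullet> S (x j)))" .
qed (simp add: inner_commute)

lemma psd_kernel_op_power:
  fixes S :: "'a::real_inner \<Rightarrow> 'b::real_inner"
  assumes "linear S" "\<And>x. norm (S x) \<le> K * norm x"
  shows "psd_kernel (\<lambda>xs ys. deg d xs * deg d ys *
     ((K\<^sup>2) ^ d * word_inner xs ys - word_inner (map S xs) (map S ys)))"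
proof (induction d)
  case 0
  have "(\<lambda>xs ys. deg 0 xs * deg 0 ys * ((K\<^sup>2) ^ 0 * word_inner xs ys - word_inner (map S xs) (map S ys)))
      = (\<lambda>_ _. 0)"
    by (auto simp: deg_def fun_eq_iff)
  then show ?case using psd_kernel_const[of 0] by simp
next
  case (Suc d)
  let ?k = "\<lambda>xs ys :: 'a list. deg d xs * deg d ys * word_inner xs ys"
  let ?D = "\<lambda>xs ys. deg d xs * deg d ys * ((K\<^sup>2) ^ d * word_inner xs ys - word_inner (map S xs) (map S ys))"
  have eq: "deg (Suc d) xs * deg (Suc d) ys * ((K\<^sup>2) ^ Suc d * word_inner xs ys - word_inner (map S xs) (map S ys)) =
      (deg (Suc d) xs * deg (Suc d) ys * (K\<^sup>2 * (hd xs \<bullet> hd ys) - S (hd xs) \<bullet> S (hd ys))) *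
      (K ^ d * K ^ d * ?k (tl xs) (tl ys)) +
      (deg (Suc d) xs * deg (Suc d) ys * (S (hd xs) \<bullet> S (hd ys))) * (1 * 1 * ?D (tl xs) (tl ys))" for xs ys
    by (cases xs; cases ys) (auto simp: deg_def algebra_simps power2_eq_square power_mult_distrib)
  show ?case
    unfolding eq
    by (intro psd_kernel_add psd_kernel_mult
          psd_kernel_weight[OF psd_kernel_op[OF assms], of _ hd]
          psd_kernel_weight[OF psd_kernel_inner, of _ "\<lambda>xs. S (hd xs)"]
          psd_kernel_weight[OF psd_kernel_deg[of d], of "\<lambda>_. K ^ d" tl]
          psd_kernel_weight[OF Suc, of "\<lambda>_. 1" tl])
qed

lemma psd_kernel_deg_le:
  "psd_kernel (\<lambda>xs ys :: 'a::real_inner list. word_inner xs ys - deg d xs * deg d ys * word_inner xs ys)"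
proof -
  have "word_inner xs ys - deg d xs * deg d ys * word_inner xs ys
      = (1 - deg d xs) * (1 - deg d ys) * word_inner xs ys" for xs ys :: "'a list"
    by (auto simp: deg_def word_inner_eq)
  then show ?thesis
    using psd_kernel_weight[OF psd_kernel_word_inner, of "\<lambda>xs. 1 - deg d xs" "\<lambda>xs. xs"] by simp
qed

lemma fext_norm_sq:
  fixes \<phi> :: "'a list \<Rightarrow> 'b::real_inner"
  shows "(norm (fext \<phi> u))\<^sup>2 = fext (\<lambda>xs. fext (\<lambda>ys. \<phi> xs \<bullet> \<phi> ys) u) u"
proof -
  have 1: "fext \<phi> u \<bullet> y = fext (\<lambda>xs. \<phi> xs \<bullet> y) u" for y
    by (rule fext_linear) (rule bounded_linear.linear[OF bounded_linear_inner_left])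
  have 2: "x \<bullet> fext \<phi> u = fext (\<lambda>ys. x \<bullet> \<phi> ys) u" for x
    by (rule fext_linear) (rule bounded_linear.linear[OF bounded_linear_inner_right])
  show ?thesis by (simp add: power2_norm_eq_inner 1 2) (rule fext_swap)
qed

lemma tensor_power_op_unique:
  fixes S :: "'a::real_inner \<Rightarrow> 'b::{real_inner,complete_space}"
  assumes "bounded_linear S"
  shows "\<exists>!T. bounded_linear T \<and>
     (\<forall>xs. T (tens xs) = (if length xs = d then tens (map S xs) else 0))"
proof (rule ex_ex1I)
  obtain K where K: "\<And>x. norm (S x) \<le> norm x * K" "K > 0"
    using bounded_linear.pos_bounded[OF assms] by blast
  define \<phi> where "\<phi> = (\<lambda>xs. if length xs = d then tens (map S xs) else 0)"
  have lin: "linear S" by (rule bounded_linear.linear[OF assms])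
  have "norm (fext \<phi> u) \<le> K ^ d * fnorm u" for u
  proof (rule power2_le_imp_le)
    let ?g = "\<lambda>xs ys. deg d xs * deg d ys * word_inner (map S xs) (map S ys)"
    have g: "\<phi> xs \<bullet> \<phi> ys = ?g xs ys" for xs ys
      by (simp add: \<phi>_def deg_def inner_tens word_inner_eq)
    have Kb: "norm (S x) \<le> K * norm x" for x using K(1)[of x] by (simp add: mult.commute)
    let ?A = "\<lambda>xs ys. deg d xs * deg d ys * ((K\<^sup>2) ^ d * word_inner xs ys - word_inner (map S xs) (map S ys))"
    let ?B = "\<lambda>xs ys :: 'a list. word_inner xs ys - deg d xs * deg d ys * word_inner xs ys"
    have "0 \<le> fext (\<lambda>xs. fext (\<lambda>ys. ?A xs ys + K ^ d * K ^ d * ?B xs ys) u) u"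
      by (intro psd_kernel_fext psd_kernel_add psd_kernel_op_power lin Kb
            psd_kernel_weight[OF psd_kernel_deg_le, of "\<lambda>_. K ^ d" "\<lambda>xs. xs"])
    also have "(\<lambda>xs ys. ?A xs ys + K ^ d * K ^ d * ?B xs ys)
        = (\<lambda>xs ys. (K ^ d * K ^ d) * word_inner xs ys - ?g xs ys)"
      by (auto simp: fun_eq_iff algebra_simps power2_eq_square power_mult_distrib)
    also have "fext (\<lambda>xs. fext (\<lambda>ys. (K ^ d * K ^ d) * word_inner xs ys - ?g xs ys) u) u
        = (K ^ d * K ^ d) * finner u u - fext (\<lambda>xs. fext (?g xs) u) u"
      by (simp only: fext_diff fext_mult finner_def)
    finally show "(norm (fext \<phi> u))\<^sup>2 \<le> (K ^ d * fnorm u)\<^sup>2"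
      by (simp add: fext_norm_sq g power_mult_distrib fnorm_sq) (simp add: power2_eq_square)
  qed (use K in simp)
  then show "\<exists>T. bounded_linear T \<and>
     (\<forall>xs. T (tens xs) = (if length xs = d then tens (map S xs) else 0))"
    using fock_extension[of \<phi>] unfolding \<phi>_def by blast
next
  fix T T' :: "'a fock \<Rightarrow> 'b fock"
  assume "bounded_linear T \<and> (\<forall>xs. T (tens xs) = (if length xs = d then tens (map S xs) else 0))"
    "bounded_linear T' \<and> (\<forall>xs. T' (tens xs) = (if length xs = d then tens (map S xs) else 0))"
  then show "T = T'" by (intro bounded_linear_fock_eqI) auto
qed

lemma tensor_power_op_props:
  fixes S :: "'a::real_inner \<Rightarrow> 'b::{real_inner,complete_space}"
  assumes "bounded_linear S"
  shows "bounded_linear (tensor_power_op d S)"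
    and "tensor_power_op d S (tens xs) = (if length xs = d then tens (map S xs) else 0)"
proof -
  have *: "bounded_linear (tensor_power_op d S) \<and>
      (\<forall>xs. tensor_power_op d S (tens xs) = (if length xs = d then tens (map S xs) else 0))"
    unfolding tensor_power_op_def by (rule theI'[OF tensor_power_op_unique[OF assms]])
  then show "bounded_linear (tensor_power_op d S)" ..
  show "tensor_power_op d S (tens xs) = (if length xs = d then tens (map S xs) else 0)"
    using * by (rule conjunct2[THEN spec])
qed

lemma tensor_power_functional_inner:
  fixes v :: "'a::real_inner"
  shows "tensor_power_functional d (\<lambda>x. x \<bullet> v) = (\<lambda>f. f \<bullet> tens (replicate d v))"
  unfolding tensor_power_functional_def
proof (rule the_equality)
  have prod: "(\<Prod>x\<leftarrow>xs. x \<bullet> v) = (\<Prod>i<length xs. xs ! i \<bullet> v)" for xs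
    by (induction xs) (simp_all add: prod.lessThan_Suc_shift del: prod.lessThan_Suc)
  show *: "bounded_linear (\<lambda>f. f \<bullet> tens (replicate d v)) \<and>
    (\<forall>xs. tens xs \<bullet> tens (replicate d v) = (if length xs = d then \<Prod>x\<leftarrow>xs. x \<bullet> v else 0))"
    by (auto simp: inner_tens prod bounded_linear_inner_left)
  fix T :: "'a fock \<Rightarrow> real"
  assume "bounded_linear T \<and> (\<forall>xs. T (tens xs) = (if length xs = d then \<Prod>x\<leftarrow>xs. x \<bullet> v else 0))"
  with * show "T = (\<lambda>f. f \<bullet> tens (replicate d v))"
    by (intro bounded_linear_fock_eqI) auto
qed

section \<open>Reproducing kernel Hilbert spaces\<close>

text \<open>
  A reproducing kernel Hilbert space of real functions on \<open>D\<close> is given by a Hilbert space type together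
  with \<open>ev\<close>, where \<open>ev f t\<close> is the value of \<open>f\<close> at \<open>t\<close>; vectors are determined by their
  values on \<open>D\<close>, and the second condition is the existence of the reproducing kernel
  \<open>K\<close>, with \<open>k = K(\<cdot>, t)\<close>.
\<close>

definition rkhs :: "real set \<Rightarrow> ('f::{real_inner,complete_space} \<Rightarrow> real \<Rightarrow> real) \<Rightarrow> bool" where
  "rkhs D ev \<longleftrightarrow>
     (\<forall>f g. (\<forall>t\<in>D. ev f t = ev g t) \<longrightarrow> f = g) \<and>
     (\<forall>t\<in>D. \<exists>k. \<forall>f. ev f t = f \<bullet> k)"

definition kernel_section :: "('f::real_inner \<Rightarrow> real \<Rightarrow> real) \<Rightarrow> real \<Rightarrow> 'f" where
  "kernel_section ev t = (THE k. \<forall>f. ev f t = f \<bullet> k)"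

lemma kernel_section:
  assumes "rkhs D ev" "t \<in> D"
  shows "ev f t = f \<bullet> kernel_section ev t"
proof -
  obtain k where k: "\<forall>f. ev f t = f \<bullet> k" using assms unfolding rkhs_def by blast
  have "kernel_section ev t = k"
    unfolding kernel_section_def
  proof (rule the_equality[where P = "\<lambda>k. \<forall>f. ev f t = f \<bullet> k"])
    fix l assume l: "\<forall>f. ev f t = f \<bullet> l"
    have "(l - k) \<bullet> l = (l - k) \<bullet> k"
      using k[rule_format, of "l - k"] l[rule_format, of "l - k"] by (rule trans[OF sym, rotated])
    then have "(l - k) \<bullet> (l - k) = 0" by (simp only: inner_diff_right right_minus_eq)
    then show "l = k" by simp
  qed (rule k)
  then show ?thesis using k by simp
qed

text \<open>
  The value at \<open>t = (t\<^sub>1, \<dots>, t\<^sub>d)\<close> of an element of the \<open>d\<close>-th tensor power, regarded as a function in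
  the space with kernel \<open>K\<^sub>d(x, y) = \<Prod>\<^sub>j K(x\<^sub>j, y\<^sub>j)\<close>: by the reproducing property it is the inner product
  with \<open>K\<^sub>d(\<cdot>, t)\<close>, the elementary tensor of the \<open>K(\<cdot>, t\<^sub>j)\<close>.
\<close>

definition tensor_eval ::
  "('f::real_inner \<Rightarrow> real \<Rightarrow> real) \<Rightarrow> real list \<Rightarrow> 'f fock \<Rightarrow> real" where
  "tensor_eval ev t f = f \<bullet> tens (map (kernel_section ev) t)"

lemma tensor_eval_tens:
  assumes "rkhs D ev" "set t \<subseteq> D" "length xs = length t"
  shows "tensor_eval ev t (tens xs) = (\<Prod>j<length t. ev (xs ! j) (t ! j))"
  using assms(2,3)
  by (auto simp: tensor_eval_def inner_tens kernel_section[OF assms(1)] subset_eq intro!: prod.cong)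

definition std_info ::
  "real set \<Rightarrow> ('f::real_inner \<Rightarrow> real \<Rightarrow> real) \<Rightarrow> nat \<Rightarrow> ('f fock \<Rightarrow> real) set" where
  "std_info D ev d = tensor_eval ev ` {t. length t = d \<and> set t \<subseteq> D}"

section \<open>Compact operators and eigenvalues\<close>

definition compact_operator :: "('a::real_normed_vector \<Rightarrow> 'b::real_normed_vector) \<Rightarrow> bool" where
  "compact_operator S \<longleftrightarrow> bounded_linear S \<and> compact (closure (S ` cball 0 1))"

text \<open>
  For a compact positive operator \<open>W\<close>: \<open>lam 1 \<ge> lam 2 \<ge> \<dots> \<ge> 0\<close> contains every positive eigenvalue as
  often as its (finite) multiplicity, and no other positive number; if there are only finitely many
  positive eigenvalues, the remaining entries are zero.  The value \<open>lam 0\<close> is irrelevant.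
\<close>

definition eigenvalue_list :: "('a::real_normed_vector \<Rightarrow> 'a) \<Rightarrow> (nat \<Rightarrow> real) \<Rightarrow> bool" where
  "eigenvalue_list W lam \<longleftrightarrow>
     (\<forall>m n. 1 \<le> m \<longrightarrow> m \<le> n \<longrightarrow> lam n \<le> lam m) \<and>
     (\<forall>n\<ge>1. 0 \<le> lam n) \<and>
     (\<forall>\<mu>>0. finite {n. 1 \<le> n \<and> lam n = \<mu>} \<and>
        card {n. 1 \<le> n \<and> lam n = \<mu>} = dim {x. W x = \<mu> *\<^sub>R x})"

section \<open>Minimal errors, information complexity, tractability\<close>

text \<open>
  For \<open>n = 0\<close> the sum is empty and \<open>minimal_error F \<Lambda> H T 0\<close> is the operator norm of \<open>T\<close> on \<open>F\<close>.
\<close>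

definition minimal_error ::
  "'a::real_normed_vector set \<Rightarrow> ('a \<Rightarrow> real) set \<Rightarrow> 'b::real_normed_vector set \<Rightarrow> ('a \<Rightarrow> 'b) \<Rightarrow> nat \<Rightarrow> real"
where
  "minimal_error F \<Lambda> H T n =
     (INF (L, g) \<in> {(L, g). \<forall>j\<in>{1..n}. L j \<in> \<Lambda> \<and> g j \<in> H}.
        SUP f \<in> {f \<in> F. norm f \<le> 1}. norm (T f - (\<Sum>j=1..n. L j f *\<^sub>R g j)))"

text \<open>The infimum in \<open>enat\<close> is the minimum, and \<open>\<infinity>\<close> if no \<open>n\<close> qualifies.\<close>

definition info_complexity ::
  "'a::real_normed_vector set \<Rightarrow> ('a \<Rightarrow> real) set \<Rightarrow> 'b::real_normed_vector set \<Rightarrow> ('a \<Rightarrow> 'b) \<Rightarrow> real \<Rightarrow> enat"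
where
  "info_complexity F \<Lambda> H T \<epsilon> =
     (INF n \<in> {n. minimal_error F \<Lambda> H T n \<le> \<epsilon> * minimal_error F \<Lambda> H T 0}. enat n)"

text \<open>In the following, \<open>N \<epsilon> d\<close> is the information complexity of the \<open>d\<close>-variate problem.\<close>

definition curse_of_dimensionality :: "(real \<Rightarrow> nat \<Rightarrow> enat) \<Rightarrow> bool" where
  "curse_of_dimensionality N \<longleftrightarrow>
     (\<exists>c>0. \<exists>C>0. \<exists>\<epsilon>0. 0 < \<epsilon>0 \<and> \<epsilon>0 < 1 \<and>
        infinite {d. 1 \<le> d \<and> (\<forall>\<epsilon>. 0 < \<epsilon> \<and> \<epsilon> \<le> \<epsilon>0 \<longrightarrow>
           ereal (C * (1 + c) ^ d) \<le> ereal_of_enat (N \<epsilon> d))})"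

definition quasi_polynomially_tractable :: "(real \<Rightarrow> nat \<Rightarrow> enat) \<Rightarrow> bool" where
  "quasi_polynomially_tractable N \<longleftrightarrow>
     (\<exists>C\<ge>0. \<exists>t\<ge>0. \<forall>\<epsilon> d. 0 < \<epsilon> \<and> \<epsilon> < 1 \<and> 1 \<le> d \<longrightarrow>
        ereal_of_enat (N \<epsilon> d) \<le> ereal (C * exp (t * (1 + ln (1 / \<epsilon>)) * (1 + ln (real d)))))"

definition polynomially_tractable :: "(real \<Rightarrow> nat \<Rightarrow> enat) \<Rightarrow> bool" where
  "polynomially_tractable N \<longleftrightarrow>
     (\<exists>C\<ge>0. \<exists>p\<ge>0. \<exists>q\<ge>0. \<forall>\<epsilon> d. 0 < \<epsilon> \<and> \<epsilon> < 1 \<and> 1 \<le> d \<longrightarrow>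
        ereal_of_enat (N \<epsilon> d) \<le> ereal (C * \<epsilon> powr (- p) * real d powr q))"

end

theory Submission
  imports Defs
begin

text \<open>
  With \<open>g = S\<^sub>1 \<eta>\<^sub>1 / \<lambda>\<^sub>1\<^sup>1\<^sup>/\<^sup>2\<close>, a unit vector, one has \<open>I\<^sub>1 f = \<langle>S\<^sub>1 f, g\<rangle>\<close> and hence
  \<open>I\<^sub>d f = \<langle>S\<^sub>d f, g \<otimes> \<dots> \<otimes> g\<rangle>\<close>.  Pairing the output of an algorithm for \<open>S\<^sub>d\<close> with the unit vector
  \<open>g \<otimes> \<dots> \<otimes> g\<close> gives an algorithm for \<open>I\<^sub>d\<close> that uses the same function values and has no larger
  error.  The initial errors agree: \<open>\<parallel>S\<^sub>d\<parallel> = \<parallel>S\<^sub>1\<parallel>\<^sup>d = \<lambda>\<^sub>1\<^sup>d\<^sup>/\<^sup>2 = \<parallel>I\<^sub>d\<parallel>\<close>, because \<open>\<parallel>S\<^sub>1\<parallel>\<^sup>2\<close> is an eigenvalue of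
  finite multiplicity of the compact operator \<open>S\<^sub>1\<^sup>*S\<^sub>1\<close>.  So the information complexity of \<open>I\<^sub>d\<close> is at
  most that of \<open>S\<^sub>d\<close>.
\<close>

section \<open>Adjoints of bounded operators on Hilbert spaces\<close>

text \<open>The representing vector is the minimizer of \<open>\<parallel>x\<parallel>\<^sup>2 - 2 \<phi>(x)\<close>.\<close>

lemma riesz_representation:
  fixes \<phi> :: "'a::{real_inner,complete_space} \<Rightarrow> real"
  assumes "bounded_linear \<phi>"
  shows "\<exists>k. \<forall>f. \<phi> f = f \<bullet> k"
proof -
  interpret bounded_linear \<phi> by fact
  define J where "J = (\<lambda>x. x \<bullet> x - 2 * \<phi> x)"
  define m where "m = Inf (range J)"
  obtain K where K: "\<And>x. norm (\<phi> x) \<le> norm x * K" using bounded by blast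
  \<comment> \<open>Completing the square in \<open>norm x\<close> after bounding
    \<open>\<phi> x\<close> by \<open>norm x * K\<close>.\<close>
  have "- K\<^sup>2 \<le> J x" for x
  proof -
    have "0 \<le> (norm x - K)\<^sup>2" by simp
    moreover have "\<phi> x \<le> norm x * K" using K[of x] by simp
    ultimately show ?thesis
      unfolding J_def by (simp add: power2_diff flip: power2_norm_eq_inner)
  qed
  then have bdd: "bdd_below (range J)" by (intro bdd_belowI[of _ "- K\<^sup>2"]) auto
  have mJ: "m \<le> J x" for x unfolding m_def by (rule cINF_lower[OF bdd]) simp
  have "\<exists>x. J x < m + 1 / real (Suc n)" for n
    using cINF_less_iff[of UNIV J "m + 1 / real (Suc n)"] bdd unfolding m_def by auto
  then obtain x where x: "\<And>n. J (x n) < m + 1 / real (Suc n)" by metis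
  \<comment> \<open>The parallelogram law: the linear part of \<open>J\<close> cancels. Since the
    midpoint has value at least \<open>m\<close>, two near-minimizers must be close to each
    other.\<close>
  have par: "(norm (u - v))\<^sup>2 / 2 = J u + J v - 2 * J ((1/2) *\<^sub>R (u + v))" for u v
    unfolding J_def power2_norm_eq_inner
    by (simp add: add scaleR inner_add_left inner_add_right inner_diff_left inner_diff_right
        inner_commute field_simps)
  have "Cauchy x"
  proof (rule metric_CauchyI)
    fix e :: real assume e: "e > 0"
    \<comment> \<open>If both values lie below \<open>m + e\<^sup>2 / 4\<close>, then
      \<open>par\<close> makes half the squared distance smaller than
      \<open>e\<^sup>2 / 2\<close>.\<close>
    then have "e\<^sup>2 / 4 > 0" by simp
    then obtain N where N: "1 / real (Suc N) < e\<^sup>2 / 4" using nat_approx_posE by blast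
    have J: "J (x n) < m + e\<^sup>2 / 4" if "n \<ge> N" for n
      using x[of n] N that frac_le[of 1 1 "real (Suc N)" "real (Suc n)"] by simp
    have "dist (x i) (x j) < e" if "i \<ge> N" "j \<ge> N" for i j
    proof (rule power2_less_imp_less)
      show "(dist (x i) (x j))\<^sup>2 < e\<^sup>2"
        using par[of "x i" "x j"] J[OF that(1)] J[OF that(2)] mJ[of "(1/2) *\<^sub>R (x i + x j)"]
        by (simp add: dist_norm)
    qed (use e in simp)
    then show "\<exists>N. \<forall>i\<ge>N. \<forall>j\<ge>N. dist (x i) (x j) < e" by blast
  qed
  then obtain k where k: "x \<longlonglongrightarrow> k" by (auto simp: Cauchy_convergent_iff convergent_def)
  have "J k \<le> m + 0"
  proof (rule LIMSEQ_le)
    show "(\<lambda>n. J (x n)) \<longlonglongrightarrow> J k" unfolding J_def by (intro tendsto_intros tendsto k)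
    show "(\<lambda>n. m + 1 / real (Suc n)) \<longlonglongrightarrow> m + 0"
      by (intro tendsto_add tendsto_const LIMSEQ_Suc[OF lim_1_over_n])
  qed (use x less_imp_le in blast)
  then have min: "J k \<le> J y" for y using mJ[of y] by simp
  have "\<phi> y = y \<bullet> k" for y
  proof (rule ccontr)
    assume ne: "\<phi> y \<noteq> y \<bullet> k"
    define d where "d = \<phi> y - y \<bullet> k"
    have expand: "J (k + t *\<^sub>R y) = J k - 2 * t * d + t\<^sup>2 * (y \<bullet> y)" for t
      unfolding J_def d_def
      by (simp add: add scaleR inner_add_left inner_add_right inner_commute
          algebra_simps power2_eq_square)
    have q: "2 * t * d \<le> t\<^sup>2 * (y \<bullet> y)" for t
      using min[of "k + t *\<^sub>R y"] expand[of t] by simp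
    have "y \<noteq> 0" using ne zero by auto
    then have y: "y \<bullet> y > 0" by simp
    \<comment> \<open>The chosen \<open>t\<close> minimizes the quadratic polynomial
      \<open>t\<^sup>2 * (y \<bullet> y) - 2 * t * d\<close>, which \<open>q\<close> says is never
      negative.\<close>
    have "2 * d\<^sup>2 \<le> d\<^sup>2"
      using q[of "d / (y \<bullet> y)"] y by (simp add: field_simps power2_eq_square)
    then show False using ne by (simp add: d_def)
  qed
  then show ?thesis by blast
qed

text \<open>\<open>adjoint\<close> is defined by Hilbert choice, so its characteristic equation
  holds as soon as some map satisfies it. The Riesz representation supplies the value of such a map
  at each \<open>y\<close>.\<close>

lemma adjoint_works_hilbert:
  fixes S :: "'a::{real_inner,complete_space} \<Rightarrow> 'b::real_inner"
  assumes "bounded_linear S"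
  shows "S x \<bullet> y = x \<bullet> adjoint S y"
proof -
  have "\<exists>k. \<forall>x. S x \<bullet> y = x \<bullet> k" for y
    by (intro riesz_representation bounded_linear_compose[OF bounded_linear_inner_left assms])
  then have "\<exists>S'. \<forall>x y. S x \<bullet> y = x \<bullet> S' y" by metis
  from someI_ex[OF this] show ?thesis unfolding adjoint_def by blast
qed

lemma norm_adjoint_le:
  fixes S :: "'a::{real_inner,complete_space} \<Rightarrow> 'b::real_inner"
  assumes "bounded_linear S"
  shows "norm (adjoint S y) \<le> onorm S * norm y"
proof (cases "adjoint S y = 0")
  case False
  have "(norm (adjoint S y))\<^sup>2 = S (adjoint S y) \<bullet> y"
    by (simp add: power2_norm_eq_inner adjoint_works_hilbert[OF assms])
  also have "\<dots> \<le> norm (S (adjoint S y)) * norm y" by (rule norm_cauchy_schwarz)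
  also have "\<dots> \<le> (onorm S * norm (adjoint S y)) * norm y"
    by (intro mult_right_mono onorm[OF assms] norm_ge_zero)
  finally show ?thesis using False by (simp add: power2_eq_square mult_ac)
qed (simp add: onorm_pos_le[OF assms])

lemma bounded_linear_adjoint:
  fixes S :: "'a::{real_inner,complete_space} \<Rightarrow> 'b::real_inner"
  assumes "bounded_linear S"
  shows "bounded_linear (adjoint S)"
proof (rule bounded_linear_intro[where K = "onorm S"])
  note adj = adjoint_works_hilbert[OF assms, symmetric]
  fix x y :: 'b and r :: real
  show "adjoint S (x + y) = adjoint S x + adjoint S y"
    by (rule vector_eq_ldot[THEN iffD1]) (simp add: adj inner_add_right)
  show "adjoint S (r *\<^sub>R x) = r *\<^sub>R adjoint S x"
    by (rule vector_eq_ldot[THEN iffD1]) (simp add: adj)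
  show "norm (adjoint S x) \<le> norm x * onorm S"
    using norm_adjoint_le[OF assms, of x] by (simp add: mult.commute)
qed

section \<open>The largest eigenvalue of a compact operator\<close>

text \<open>The vectors of an orthonormal family in the eigenspace have images that are
  \<open>(2\<mu>)\<^sup>1\<^sup>/\<^sup>2\<close> apart, and these images lie in a totally bounded set.\<close>

lemma eigenspace_finite_dimensional:
  fixes S :: "'a::{real_inner,complete_space} \<Rightarrow> 'b::real_inner"
  assumes "compact_operator S" "\<mu> > 0"
  shows "\<exists>A. finite A \<and> {x. (adjoint S \<circ> S) x = \<mu> *\<^sub>R x} \<subseteq> span A"
proof -
  let ?E = "{x. (adjoint S \<circ> S) x = \<mu> *\<^sub>R x}"
  have S: "bounded_linear S" and cpt: "compact (closure (S ` cball 0 1))"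
    using assms(1) by (auto simp: compact_operator_def)
  interpret S: bounded_linear S by fact
  interpret A: bounded_linear "adjoint S" by (rule bounded_linear_adjoint[OF S])
  note adj = adjoint_works_hilbert[OF S]
  \<comment> \<open>Points in a common ball of radius \<open>r\<close> are less than
    \<open>sqrt \<mu>\<close> apart, whereas images of distinct orthonormal eigenvectors have
    distance \<open>sqrt (2 * \<mu>)\<close>. Hence each ball of the finite cover holds at most one
    image.\<close>
  define r where "r = sqrt \<mu> / 2"
  have r: "r > 0" using assms(2) by (simp add: r_def)
  then obtain k where k: "finite k" "closure (S ` cball 0 1) \<subseteq> (\<Union>x\<in>k. ball x r)"
    using cpt unfolding compact_eq_totally_bounded by blast
  let ?P = "\<lambda>B. finite B \<and> B \<subseteq> ?E \<and> (\<forall>a\<in>B. \<forall>b\<in>B. a \<bullet> b = (if a = b then 1 else 0))"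
  have bound: "card B \<le> card k" if B: "?P B" for B
  proof -
    have "\<exists>c\<in>k. S a \<in> ball c r" if "a \<in> B" for a
    proof -
      have "a \<bullet> a = 1" using B that by auto
      then have "norm a = 1" by (simp add: norm_eq_sqrt_inner)
      then have "S a \<in> closure (S ` cball 0 1)"
        by (intro subsetD[OF closure_subset] imageI) simp
      then show ?thesis using k(2) by blast
    qed
    then obtain c where c: "\<And>a. a \<in> B \<Longrightarrow> c a \<in> k \<and> S a \<in> ball (c a) r" by metis
    have "inj_on c B"
    proof (rule inj_onI, rule ccontr)
      fix a b assume ab: "a \<in> B" "b \<in> B" "c a = c b" "a \<noteq> b"
      have "dist (S a) (S b) < 2 * r"
        using c[OF ab(1)] c[OF ab(2)] ab(3) dist_triangle_half_r[of "c a" "S a" "2 * r" "S b"] by simp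
      then have "(dist (S a) (S b))\<^sup>2 < (2 * r)\<^sup>2" by (rule power_strict_mono) simp_all
      moreover have "(dist (S a) (S b))\<^sup>2 = 2 * \<mu>"
      proof -
        have in_E: "adjoint S (S a) = \<mu> *\<^sub>R a" "adjoint S (S b) = \<mu> *\<^sub>R b" using B ab by auto
        have "(dist (S a) (S b))\<^sup>2 = (a - b) \<bullet> adjoint S (S (a - b))"
          by (simp add: dist_norm power2_norm_eq_inner flip: S.diff adj)
        also have "\<dots> = \<mu> * ((a - b) \<bullet> (a - b))"
          by (simp add: S.diff A.diff in_E flip: scaleR_diff_right)
        also have "(a - b) \<bullet> (a - b) = 2"
          using B ab by (simp add: inner_diff_left inner_diff_right)
        finally show ?thesis by simp
      qed
      ultimately show False using assms(2) by (simp add: r_def)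
    qed
    then show ?thesis using c k(1) by (intro card_inj_on_le[of c]) auto
  qed
  \<comment> \<open>The cardinalities are bounded by \<open>card k\<close>, so an orthonormal family
    of largest size exists.\<close>
  have "\<exists>B. ?P B \<and> (\<forall>C. ?P C \<longrightarrow> card C \<le> card B)"
  proof (rule ex_has_greatest_nat[of ?P "{}" card "Suc (card k)"])
    show "\<forall>B. ?P B \<longrightarrow> card B < Suc (card k)" using bound by (simp add: less_Suc_eq_le)
  qed simp
  then obtain B where B: "?P B" and max: "\<And>C. ?P C \<Longrightarrow> card C \<le> card B" by blast
  \<comment> \<open>Otherwise \<open>x\<close> minus its projection onto \<open>span B\<close> is a
    nonzero eigenvector orthogonal to \<open>B\<close>. Normalized, it would enlarge the maximal
    family.\<close>
  have "x \<in> span B" if x: "x \<in> ?E" for x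
  proof (rule ccontr)
    assume notin: "x \<notin> span B"
    define p where "p = (\<Sum>b\<in>B. (x \<bullet> b) *\<^sub>R b)"
    define y where "y = x - p"
    have "p \<in> span B" unfolding p_def by (intro span_sum span_mul span_base)
    then have y0: "y \<noteq> 0" using notin by (auto simp: y_def)
    have yE: "y \<in> ?E"
    proof -
      have "adjoint S (S p) = (\<Sum>b\<in>B. (x \<bullet> b) *\<^sub>R adjoint S (S b))"
        unfolding p_def by (simp add: S.sum A.sum S.scaleR A.scaleR)
      also have "\<dots> = (\<Sum>b\<in>B. (x \<bullet> b) *\<^sub>R \<mu> *\<^sub>R b)"
        using B by (intro sum.cong) auto
      also have "\<dots> = \<mu> *\<^sub>R p" by (simp add: p_def scaleR_sum_right mult_ac)
      finally show ?thesis using x by (simp add: y_def S.diff A.diff scaleR_diff_right)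
    qed
    have orth: "y \<bullet> b = 0" if "b \<in> B" for b
    proof -
      have "p \<bullet> b = (\<Sum>c\<in>B. if c = b then x \<bullet> b else 0)"
        unfolding p_def inner_sum_left using B that by (intro sum.cong) auto
      then show ?thesis using B that by (simp add: y_def inner_diff_left)
    qed
    define z where "z = (1 / norm y) *\<^sub>R y"
    have z: "z \<in> ?E" "z \<bullet> z = 1" "\<And>b. b \<in> B \<Longrightarrow> z \<bullet> b = 0" "\<And>b. b \<in> B \<Longrightarrow> b \<bullet> z = 0"
      using yE y0 orth
      by (auto simp: z_def S.scaleR A.scaleR inner_commute dot_square_norm power2_eq_square)
    then have "z \<notin> B" by fastforce
    moreover have "?P (insert z B)" using B z \<open>z \<notin> B\<close> by auto
    ultimately show False using max[of "insert z B"] B by simp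
  qed
  then show ?thesis using B by blast
qed

text \<open>\<open>dim\<close> is the cardinality of a basis, and \<open>card\<close> is 0 on
  infinite sets. A nonzero vector therefore forces a positive \<open>dim\<close> only together with
  the finite dimension of the eigenspace.\<close>

lemma dim_eigenspace_pos:
  fixes S :: "'a::{real_inner,complete_space} \<Rightarrow> 'b::real_inner"
  assumes "compact_operator S" "\<mu> > 0" "(adjoint S \<circ> S) x = \<mu> *\<^sub>R x" "x \<noteq> 0"
  shows "0 < dim {x. (adjoint S \<circ> S) x = \<mu> *\<^sub>R x}"
proof -
  let ?E = "{x. (adjoint S \<circ> S) x = \<mu> *\<^sub>R x}"
  obtain A where A: "finite A" "?E \<subseteq> span A" using eigenspace_finite_dimensional[OF assms(1,2)] by blast
  obtain B where B: "B \<subseteq> ?E" "independent B" "?E \<subseteq> span B" "card B = dim ?E"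
    using basis_exists by blast
  have "finite B" using independent_span_bound[OF A(1) B(2)] A(2) B(1) by blast
  moreover have "B \<noteq> {}" using B(3) assms(3,4) by auto
  ultimately show ?thesis using B(4) by (metis card_gt_0_iff)
qed

text \<open>A maximizing sequence in the unit ball has, by compactness, a subsequence
  \<open>u\<close> with convergent images. Its defects
  \<open>adjoint S (S (u n)) - s\<^sup>2 *\<^sub>R u n\<close> tend to 0, so \<open>u\<close> itself
  converges, and its limit is the eigenvector.\<close>

lemma compact_operator_norm_eigenvector:
  fixes S :: "'a::{real_inner,complete_space} \<Rightarrow> 'b::real_inner"
  assumes "compact_operator S" "0 < onorm S"
  shows "\<exists>x. x \<noteq> 0 \<and> (adjoint S \<circ> S) x = (onorm S)\<^sup>2 *\<^sub>R x"
proof -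
  define s where "s = onorm S"
  have S: "bounded_linear S" and cpt: "compact (closure (S ` cball 0 1))"
    using assms(1) by (auto simp: compact_operator_def)
  interpret S: bounded_linear S by fact
  interpret A: bounded_linear "adjoint S" by (rule bounded_linear_adjoint[OF S])
  note adj = adjoint_works_hilbert[OF S]
  have s: "s > 0" using assms(2) by (simp add: s_def)
  have ns: "norm (S x) \<le> s * norm x" for x unfolding s_def by (rule onorm[OF S])
  have na: "norm (adjoint S y) \<le> s * norm y" for y unfolding s_def by (rule norm_adjoint_le[OF S])
  \<comment> \<open>If no such point existed, homogeneity would give an operator bound strictly
    below \<open>onorm S\<close>.\<close>
  have "\<exists>x. norm x \<le> 1 \<and> s * (1 - 1 / real (Suc n)) \<le> norm (S x)" for n
  proof (rule ccontr)
    assume "\<not> ?thesis"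
    then have c: "norm (S x) < s * (1 - 1 / real (Suc n))" if "norm x \<le> 1" for x
      using that by force
    have "0 \<le> s * (1 - 1 / real (Suc n))" using s by simp
    have "onorm S \<le> s * (1 - 1 / real (Suc n))"
    proof (rule onorm_bound)
      fix x
      show "norm (S x) \<le> s * (1 - 1 / real (Suc n)) * norm x"
      proof (cases "x = 0")
        case False
        then have "norm (S ((1 / norm x) *\<^sub>R x)) < s * (1 - 1 / real (Suc n))" by (intro c) simp
        then show ?thesis using False by (simp add: S.scaleR divide_less_eq)
      qed (simp add: S.zero)
    qed fact
    moreover have "s * (1 - 1 / real (Suc n)) < s * 1" using s by (intro mult_strict_left_mono) auto
    ultimately show False by (simp add: s_def)
  qed
  then obtain x where x: "\<And>n. norm (x n) \<le> 1" "\<And>n. s * (1 - 1 / real (Suc n)) \<le> norm (S (x n))"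
    by metis
  have "S (x n) \<in> closure (S ` cball 0 1)" for n
    using x(1) by (intro subsetD[OF closure_subset] imageI) simp
  then obtain y \<sigma> where \<sigma>: "strict_mono \<sigma>" "((\<lambda>n. S (x n)) \<circ> \<sigma>) \<longlonglongrightarrow> y"
    using cpt unfolding compact_def by (metis (no_types, lifting))
  define u where "u = x \<circ> \<sigma>"
  have Su: "(\<lambda>n. S (u n)) \<longlonglongrightarrow> y" using \<sigma>(2) by (simp add: u_def comp_def)
  have lim: "(\<lambda>n. norm (S (u n))) \<longlonglongrightarrow> s"
  proof (rule tendsto_sandwich)
    have "(\<lambda>n. s * (1 - 1 / real (Suc n))) \<longlonglongrightarrow> s * (1 - 0)"
      by (intro tendsto_intros LIMSEQ_Suc[OF lim_1_over_n])
    from LIMSEQ_subseq_LIMSEQ[OF this \<sigma>(1)]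
    show "(\<lambda>n. s * (1 - 1 / real (Suc (\<sigma> n)))) \<longlonglongrightarrow> s" by (simp add: comp_def)
    have "norm (S (u n)) \<le> s" for n
      by (rule order_trans[OF ns]) (use s x(1) in \<open>simp add: u_def\<close>)
    then show "\<forall>\<^sub>F n in sequentially. norm (S (u n)) \<le> s" by simp
    show "\<forall>\<^sub>F n in sequentially. s * (1 - 1 / real (Suc (\<sigma> n))) \<le> norm (S (u n))"
      using x(2) by (simp add: u_def)
  qed simp
  have "(\<lambda>n. adjoint S (S (u n)) - s\<^sup>2 *\<^sub>R u n) \<longlonglongrightarrow> 0"
  proof -
    \<comment> \<open>Expand the square. The mixed term is
      \<open>- 2 * s\<^sup>2 * (norm (S (u n)))\<^sup>2\<close>; the other two are at most
      \<open>s\<^sup>2 * (norm (S (u n)))\<^sup>2\<close> and \<open>s ^ 4\<close>.\<close>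
    have le: "(norm (adjoint S (S (u n)) - s\<^sup>2 *\<^sub>R u n))\<^sup>2 \<le> s\<^sup>2 * (s\<^sup>2 - (norm (S (u n)))\<^sup>2)" for n
    proof -
      have "(norm (adjoint S (S (u n))))\<^sup>2 \<le> (s * norm (S (u n)))\<^sup>2"
        by (intro power_mono na norm_ge_zero)
      moreover have "s ^ 4 * (norm (u n))\<^sup>2 \<le> s ^ 4 * 1"
        using x(1)[of "\<sigma> n"] by (intro mult_left_mono power_le_one) (auto simp: u_def)
      moreover have "(norm (adjoint S (S (u n)) - s\<^sup>2 *\<^sub>R u n))\<^sup>2
          = (norm (adjoint S (S (u n))))\<^sup>2 + (norm (s\<^sup>2 *\<^sub>R u n))\<^sup>2 - 2 * (s\<^sup>2 * (norm (S (u n)))\<^sup>2)"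
      proof -
        have "adjoint S (S (u n)) \<bullet> u n = (norm (S (u n)))\<^sup>2"
          by (simp add: power2_norm_eq_inner adj inner_commute[of _ "u n"])
        then show ?thesis
          using dot_norm_neg[of "adjoint S (S (u n))" "s\<^sup>2 *\<^sub>R u n"] by simp
      qed
      moreover have "(norm (s\<^sup>2 *\<^sub>R u n))\<^sup>2 = s ^ 4 * (norm (u n))\<^sup>2"
        by (simp add: power_mult_distrib)
      moreover have "s\<^sup>2 * (s\<^sup>2 - (norm (S (u n)))\<^sup>2) = s ^ 4 - s\<^sup>2 * (norm (S (u n)))\<^sup>2"
        by (simp add: right_diff_distrib flip: power_add)
      ultimately show ?thesis by (simp only: power_mult_distrib mult_1_right)
    qed
    have "(\<lambda>n. s\<^sup>2 * (s\<^sup>2 - (norm (S (u n)))\<^sup>2)) \<longlonglongrightarrow> s\<^sup>2 * (s\<^sup>2 - s\<^sup>2)"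
      by (intro tendsto_intros lim)
    then have "(\<lambda>n. s\<^sup>2 * (s\<^sup>2 - (norm (S (u n)))\<^sup>2)) \<longlonglongrightarrow> 0"
      by (simp only: diff_self mult_zero_right)
    then have "(\<lambda>n. (norm (adjoint S (S (u n)) - s\<^sup>2 *\<^sub>R u n))\<^sup>2) \<longlonglongrightarrow> 0"
      by (rule Lim_null_comparison[OF always_eventually, rotated]) (simp only: real_norm_def abs_power2 le simp_thms)
    from tendsto_real_sqrt[OF this] show ?thesis by (simp add: tendsto_norm_zero_iff)
  qed
  \<comment> \<open>The images converge to \<open>y\<close>, hence
    \<open>adjoint S (S (u n))\<close> tends to \<open>adjoint S y\<close>. As the defect vanishes
    in the limit, convergence passes to \<open>u\<close>.\<close>
  from tendsto_diff[OF A.tendsto[OF Su] this] have "(\<lambda>n. s\<^sup>2 *\<^sub>R u n) \<longlonglongrightarrow> adjoint S y" by simp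
  from tendsto_scaleR[OF tendsto_const[of "1 / s\<^sup>2"] this] s
  have u: "u \<longlonglongrightarrow> (1 / s\<^sup>2) *\<^sub>R adjoint S y" by simp
  define v where "v = (1 / s\<^sup>2) *\<^sub>R adjoint S y"
  have Sv: "S v = y" using LIMSEQ_unique[OF S.tendsto[OF u] Su] by (simp add: v_def)
  have "norm y = s" using LIMSEQ_unique[OF tendsto_norm[OF Su] lim] .
  then have "v \<noteq> 0" using Sv s S.zero by auto
  moreover have "(adjoint S \<circ> S) v = s\<^sup>2 *\<^sub>R v" using Sv s by (simp add: v_def)
  ultimately show ?thesis unfolding s_def by blast
qed

text \<open>A positive \<open>(onorm S)\<^sup>2\<close> is an eigenvalue of positive
  \<open>dim\<close>, so it occurs in the list, whose largest entry is \<open>lam 1\<close>. The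
  list records only positive eigenvalues, hence the separate case
  \<open>onorm S = 0\<close>.\<close>

lemma onorm_le_largest_eigenvalue:
  fixes S :: "'a::{real_inner,complete_space} \<Rightarrow> 'b::real_inner"
  assumes "compact_operator S" "eigenvalue_list (adjoint S \<circ> S) lam"
  shows "(onorm S)\<^sup>2 \<le> lam 1"
proof (cases "0 < onorm S")
  case True
  define \<mu> where "\<mu> = (onorm S)\<^sup>2"
  have \<mu>: "\<mu> > 0" using True by (simp add: \<mu>_def)
  obtain x where "x \<noteq> 0" "(adjoint S \<circ> S) x = \<mu> *\<^sub>R x"
    using compact_operator_norm_eigenvector[OF assms(1) True] by (auto simp: \<mu>_def)
  then have "0 < card {n. 1 \<le> n \<and> lam n = \<mu>}"
    using dim_eigenspace_pos[OF assms(1) \<mu>] assms(2) \<mu> unfolding eigenvalue_list_def by metis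
  then obtain n where "1 \<le> n" "lam n = \<mu>" by (force simp: card_gt_0_iff)
  then show ?thesis using assms(2) unfolding eigenvalue_list_def \<mu>_def by (metis order_refl)
next
  case False
  then have "onorm S = 0"
    using onorm_pos_le[of S] assms(1) by (simp add: compact_operator_def)
  then show ?thesis using assms(2) by (simp add: eigenvalue_list_def)
qed

section \<open>Tensor powers\<close>

text \<open>Positive semidefiniteness of the kernel \<open>K ^ d * K ^ d * word_inner xs ys - T
  (tens xs) \<bullet> T (tens ys)\<close>, where \<open>T\<close> is the tensor power operator,
  gives the bound on finite combinations; density and continuity extend it. The explicit constant
  \<open>K ^ d\<close> is what the comparison of initial errors requires.\<close>

lemma norm_tensor_power_op_le:
  fixes S :: "'a::real_inner \<Rightarrow> 'b::{real_inner,complete_space}"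
  assumes S: "bounded_linear S" and K: "\<And>x. norm (S x) \<le> K * norm x" "0 \<le> K"
  shows "norm (tensor_power_op d S x) \<le> K ^ d * norm x"
proof -
  let ?T = "tensor_power_op d S"
  note T = tensor_power_op_props[OF S, of d]
  have fin: "norm (?T (femb u)) \<le> K ^ d * norm (femb u)" for u
  proof (rule power2_le_imp_le)
    \<comment> \<open>\<open>k\<close> accounts for words of length \<open>d\<close>;
      \<open>l\<close>, scaled by \<open>K ^ d * K ^ d\<close>, supplies the inner products of all
      other words, on which the operator vanishes.\<close>
    define k where "k = (\<lambda>xs ys. deg d xs * deg d ys *
      ((K\<^sup>2) ^ d * word_inner xs ys - word_inner (map S xs) (map S ys)))"
    define l where "l = (\<lambda>xs ys :: 'a list.
      word_inner xs ys - deg d xs * deg d ys * word_inner xs ys)"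
    have "psd_kernel (\<lambda>xs ys. k xs ys + K ^ d * K ^ d * l xs ys)"
      unfolding k_def l_def
      by (intro psd_kernel_add psd_kernel_op_power bounded_linear.linear S K(1)
          psd_kernel_weight[OF psd_kernel_deg_le, of "\<lambda>_. K ^ d" "\<lambda>xs. xs"])
    then have "0 \<le> fext (\<lambda>xs. fext (\<lambda>ys. k xs ys + K ^ d * K ^ d * l xs ys) u) u"
      by (rule psd_kernel_fext)
    also have "(\<lambda>xs ys. k xs ys + K ^ d * K ^ d * l xs ys)
        = (\<lambda>xs ys. (K ^ d * K ^ d) * word_inner xs ys - ?T (tens xs) \<bullet> ?T (tens ys))"
      by (auto simp: k_def l_def fun_eq_iff T(2) inner_tens deg_def word_inner_eq
          algebra_simps power2_eq_square power_mult_distrib)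
    also have "fext (\<lambda>xs. fext (\<lambda>ys. (K ^ d * K ^ d) * word_inner xs ys
          - ?T (tens xs) \<bullet> ?T (tens ys)) u) u
        = (K ^ d * K ^ d) * finner u u - (norm (?T (femb u)))\<^sup>2"
      by (simp only: fext_diff fext_mult finner_def femb_eq fext_norm_sq
          fext_linear[OF bounded_linear.linear[OF T(1)]])
    finally show "(norm (?T (femb u)))\<^sup>2 \<le> (K ^ d * norm (femb u))\<^sup>2"
      by (simp add: power_mult_distrib norm_femb fnorm_sq) (simp add: power2_eq_square)
  qed (use K(2) in simp)
  obtain X where X: "(\<lambda>n. femb (X n)) \<longlonglongrightarrow> x" using femb_dense by blast
  show ?thesis
    by (rule LIMSEQ_le[OF tendsto_norm[OF bounded_linear.tendsto[OF T(1) X]]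
          tendsto_mult[OF tendsto_const tendsto_norm[OF X]]]) (use fin in blast)
qed

lemma zero_in_tensor_power: "0 \<in> tensor_power d"
  unfolding tensor_power_def by (intro subsetD[OF closure_subset] span_zero)

lemma tens_in_tensor_power: "length xs = d \<Longrightarrow> tens xs \<in> tensor_power d"
  unfolding tensor_power_def by (intro subsetD[OF closure_subset] span_base) auto

lemma norm_tens_replicate: "norm (tens (replicate d v)) = norm v ^ d"
  by (simp add: norm_eq_sqrt_inner inner_tens real_sqrt_power)

lemma bounded_linear_std_info:
  "L \<in> std_info D ev d \<Longrightarrow> bounded_linear L"
  unfolding std_info_def tensor_eval_def by (auto simp: bounded_linear_inner_left)

section \<open>Minimal errors\<close>

text \<open>A real \<open>SUP\<close> is a genuine supremum only over a set that is bounded above.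
  This provides the bound for every worst case error in use.\<close>

lemma bdd_above_error:
  assumes "bounded_linear T" "\<forall>j\<in>{1..n}. bounded_linear (L j)"
  shows "bdd_above ((\<lambda>f. norm (T f - (\<Sum>j=1..n. L j f *\<^sub>R g j))) ` {f \<in> F. norm f \<le> 1})"
proof -
  have "bounded_linear (\<lambda>f. T f - (\<Sum>j=1..n. L j f *\<^sub>R g j))"
    using assms
    by (intro bounded_linear_sub bounded_linear_sum bounded_linear_scaleR_const) auto
  then obtain K where K: "\<And>f. norm (T f - (\<Sum>j=1..n. L j f *\<^sub>R g j)) \<le> norm f * K" "K > 0"
    using bounded_linear.pos_bounded by blast
  show ?thesis
  proof (rule bdd_aboveI2)
    fix f assume "f \<in> {f \<in> F. norm f \<le> 1}"
    then have "norm f * K \<le> 1 * K" using K(2) by (intro mult_right_mono) auto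
    then show "norm (T f - (\<Sum>j=1..n. L j f *\<^sub>R g j)) \<le> K" using K(1)[of f] by simp
  qed
qed

text \<open>An admissible pair \<open>(L, g)\<close> for \<open>T\<close> is turned into
  \<open>(L, \<lambda>j. g j \<bullet> w)\<close>. The residual \<open>r\<close> becomes
  \<open>r \<bullet> w\<close>, which Cauchy-Schwarz bounds by \<open>norm r\<close>.\<close>

lemma minimal_error_inner_le:
  fixes T :: "'a::real_normed_vector \<Rightarrow> 'b::real_inner"
  assumes T: "bounded_linear T" and \<Lambda>: "\<And>L. L \<in> \<Lambda> \<Longrightarrow> bounded_linear L" "\<Lambda> \<noteq> {}"
    and F: "0 \<in> F" and H: "0 \<in> H" and w: "norm w \<le> 1"
  shows "minimal_error F \<Lambda> UNIV (\<lambda>f. T f \<bullet> w) n \<le> minimal_error F \<Lambda> H T n"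
  unfolding minimal_error_def
proof (rule cINF_mono)
  let ?e = "\<lambda>L g. SUP f\<in>{f \<in> F. norm f \<le> 1}. norm (T f \<bullet> w - (\<Sum>j=1..n. L j f *\<^sub>R g j))"
  have Tw: "bounded_linear (\<lambda>f. T f \<bullet> w)"
    by (intro bounded_linear_compose[OF bounded_linear_inner_left T])
  \<comment> \<open>A real infimum over the empty set carries no information, so an admissible pair
    is exhibited: a constant choice from \<open>\<Lambda>\<close> with zero coefficients.\<close>
  obtain L0 where "L0 \<in> \<Lambda>" using \<Lambda>(2) by blast
  then have "(\<lambda>_. L0, \<lambda>_. 0) \<in> {(L, g). \<forall>j\<in>{1..n}. L j \<in> \<Lambda> \<and> g j \<in> H}" using H by simp
  then show "{(L, g). \<forall>j\<in>{1..n}. L j \<in> \<Lambda> \<and> g j \<in> H} \<noteq> {}" by (metis empty_iff)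
  show "bdd_below ((\<lambda>(L, g). ?e L g) ` {(L, g). \<forall>j\<in>{1..n}. L j \<in> \<Lambda> \<and> g j \<in> UNIV})"
  proof (rule bdd_belowI2[of _ 0])
    fix p assume "p \<in> {(L, g). \<forall>j\<in>{1..n}. L j \<in> \<Lambda> \<and> g j \<in> (UNIV :: real set)}"
    then obtain L g where p: "p = (L, g)" and L: "\<forall>j\<in>{1..n}. L j \<in> \<Lambda>" by auto
    then have "\<forall>j\<in>{1..n}. bounded_linear (L j)" using \<Lambda>(1) by blast
    from bdd_above_error[OF Tw this] have "0 \<le> ?e L g"
      by (rule cSUP_upper2[of _ _ 0]) (use F in simp_all)
    then show "0 \<le> (\<lambda>(L, g). ?e L g) p" by (simp only: p prod.case)
  qed
  fix m assume "m \<in> {(L, g). \<forall>j\<in>{1..n}. L j \<in> \<Lambda> \<and> g j \<in> H}"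
  then obtain L g where m: "m = (L, g)" and L: "\<forall>j\<in>{1..n}. L j \<in> \<Lambda>" by auto
  have bl: "\<forall>j\<in>{1..n}. bounded_linear (L j)" using L \<Lambda>(1) by blast
  have "?e L (\<lambda>j. g j \<bullet> w) \<le> (SUP f\<in>{f \<in> F. norm f \<le> 1}. norm (T f - (\<Sum>j=1..n. L j f *\<^sub>R g j)))"
  proof (rule cSUP_mono)
    show "{f \<in> F. norm f \<le> 1} \<noteq> {}" using F by auto
    show "bdd_above ((\<lambda>f. norm (T f - (\<Sum>j=1..n. L j f *\<^sub>R g j))) ` {f \<in> F. norm f \<le> 1})"
      by (rule bdd_above_error[OF T bl])
    fix f assume f: "f \<in> {f \<in> F. norm f \<le> 1}"
    define r where "r = T f - (\<Sum>j=1..n. L j f *\<^sub>R g j)"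
    have "norm (T f \<bullet> w - (\<Sum>j=1..n. L j f *\<^sub>R (g j \<bullet> w))) = \<bar>r \<bullet> w\<bar>"
      by (simp add: r_def inner_diff_left inner_sum_left)
    also have "\<dots> \<le> norm r * norm w" by (rule Cauchy_Schwarz_ineq2)
    also have "\<dots> \<le> norm r * 1" using w by (intro mult_left_mono) auto
    finally show "\<exists>f'\<in>{f \<in> F. norm f \<le> 1}. norm (T f \<bullet> w - (\<Sum>j=1..n. L j f *\<^sub>R (g j \<bullet> w)))
        \<le> norm (T f' - (\<Sum>j=1..n. L j f' *\<^sub>R g j))"
      using f by (auto simp: r_def)
  qed
  then show "\<exists>m'\<in>{(L, g). \<forall>j\<in>{1..n}. L j \<in> \<Lambda> \<and> g j \<in> UNIV}. (\<lambda>(L, g). ?e L g) m'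
      \<le> (\<lambda>(L, g). SUP f\<in>{f \<in> F. norm f \<le> 1}. norm (T f - (\<Sum>j=1..n. L j f *\<^sub>R g j))) m"
    unfolding m prod.case
    by (intro bexI[of _ "(L, \<lambda>j. g j \<bullet> w)"])
      (use L in \<open>simp_all only: prod.case mem_Collect_eq UNIV_I simp_thms\<close>)
qed

lemma minimal_error_0:
  assumes "0 \<in> H"
  shows "minimal_error F \<Lambda> H T 0 = (SUP f\<in>{f \<in> F. norm f \<le> 1}. norm (T f))"
  unfolding minimal_error_def by (simp add: case_prod_unfold)

text \<open>The first assumption at \<open>n = 0\<close> and the second one together make the
  initial errors equal. The threshold is then common, and every \<open>n\<close> that suffices for
  \<open>T'\<close> suffices for \<open>T\<close>.\<close>

lemma info_complexity_mono:
  assumes "\<And>n. minimal_error F \<Lambda> H T n \<le> minimal_error F \<Lambda> H' T' n"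
    and "minimal_error F \<Lambda> H' T' 0 \<le> minimal_error F \<Lambda> H T 0" and "0 \<le> \<epsilon>"
  shows "info_complexity F \<Lambda> H T \<epsilon> \<le> info_complexity F \<Lambda> H' T' \<epsilon>"
  unfolding info_complexity_def
proof (rule INF_superset_mono)
  show "{n. minimal_error F \<Lambda> H' T' n \<le> \<epsilon> * minimal_error F \<Lambda> H' T' 0}
      \<subseteq> {n. minimal_error F \<Lambda> H T n \<le> \<epsilon> * minimal_error F \<Lambda> H T 0}"
    using assms(1) mult_left_mono[OF assms(2,3)] by (auto intro: order_trans)
qed simp

section \<open>Transfer of tractability\<close>

lemma curse_of_dimensionality_mono:
  assumes "\<And>\<epsilon> d. 0 < \<epsilon> \<Longrightarrow> N \<epsilon> d \<le> N' \<epsilon> d" "curse_of_dimensionality N"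
  shows "curse_of_dimensionality N'"
proof -
  obtain c C \<epsilon>0 where *: "c > 0" "C > 0" "0 < \<epsilon>0" "\<epsilon>0 < 1"
    "infinite {d. 1 \<le> d \<and> (\<forall>\<epsilon>. 0 < \<epsilon> \<and> \<epsilon> \<le> \<epsilon>0 \<longrightarrow> ereal (C * (1 + c) ^ d) \<le> ereal_of_enat (N \<epsilon> d))}"
    using assms(2) unfolding curse_of_dimensionality_def by blast
  have "{d. 1 \<le> d \<and> (\<forall>\<epsilon>. 0 < \<epsilon> \<and> \<epsilon> \<le> \<epsilon>0 \<longrightarrow> ereal (C * (1 + c) ^ d) \<le> ereal_of_enat (N \<epsilon> d))}
     \<subseteq> {d. 1 \<le> d \<and> (\<forall>\<epsilon>. 0 < \<epsilon> \<and> \<epsilon> \<le> \<epsilon>0 \<longrightarrow> ereal (C * (1 + c) ^ d) \<le> ereal_of_enat (N' \<epsilon> d))}"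
    using assms(1) ereal_of_enat_le_iff order_trans by blast
  then show ?thesis
    unfolding curse_of_dimensionality_def using * infinite_super by blast
qed

lemma quasi_polynomially_tractable_mono:
  assumes "\<And>\<epsilon> d. 0 < \<epsilon> \<Longrightarrow> N \<epsilon> d \<le> N' \<epsilon> d" "quasi_polynomially_tractable N'"
  shows "quasi_polynomially_tractable N"
  using assms unfolding quasi_polynomially_tractable_def
  by (meson ereal_of_enat_le_iff order_trans)

lemma polynomially_tractable_mono:
  assumes "\<And>\<epsilon> d. 0 < \<epsilon> \<Longrightarrow> N \<epsilon> d \<le> N' \<epsilon> d" "polynomially_tractable N'"
  shows "polynomially_tractable N"
  using assms unfolding polynomially_tractable_def
  by (meson ereal_of_enat_le_iff order_trans)

theorem corollary4:
  fixes D1 :: "real set"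
    and ev :: "'f::{real_inner,complete_space} \<Rightarrow> real \<Rightarrow> real"
    and S1 :: "'f \<Rightarrow> 'g::{real_inner,complete_space}"
    and I1 :: "'f \<Rightarrow> real"
    and lam :: "nat \<Rightarrow> real"
    and eta1 :: 'f
    and nS nI :: "real \<Rightarrow> nat \<Rightarrow> enat"
  assumes F1: "rkhs D1 ev"
    and S1: "compact_operator S1" "S1 \<noteq> (\<lambda>_. 0)"
    and lam: "eigenvalue_list (adjoint S1 \<circ> S1) lam" "lam 2 < lam 1"
    and eta1: "adjoint S1 (S1 eta1) = lam 1 *\<^sub>R eta1" "norm eta1 = 1"
    and I1: "\<And>f. I1 f = f \<bullet> (sqrt (lam 1) *\<^sub>R eta1)"
    and nS: "\<And>\<epsilon> d. nS \<epsilon> d = info_complexity (tensor_power d) (std_info D1 ev d)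
               (tensor_power d) (tensor_power_op d S1) \<epsilon>"
    and nI: "\<And>\<epsilon> d. nI \<epsilon> d = info_complexity (tensor_power d) (std_info D1 ev d)
               UNIV (tensor_power_functional d I1) \<epsilon>"
  shows "(curse_of_dimensionality nI \<longrightarrow> curse_of_dimensionality nS) \<and>
         (\<not> quasi_polynomially_tractable nI \<longrightarrow> \<not> quasi_polynomially_tractable nS) \<and>
         (\<not> polynomially_tractable nI \<longrightarrow> \<not> polynomially_tractable nS)"
proof -
  have bl: "bounded_linear S1" using S1(1) by (simp add: compact_operator_def)
  \<comment> \<open>From \<open>lam 1 > lam 2\<close> and \<open>lam 2 \<ge> 0\<close>.\<close>
  have lam1: "lam 1 > 0" using lam unfolding eigenvalue_list_def by (meson le_less_trans one_le_numeral)
  define g where "g = (1 / sqrt (lam 1)) *\<^sub>R S1 eta1"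
  have I1g: "I1 f = S1 f \<bullet> g" for f
  proof -
    have "S1 f \<bullet> g = (lam 1 / sqrt (lam 1)) * (f \<bullet> eta1)"
      by (simp add: g_def adjoint_works_hilbert[OF bl] eta1(1)[simplified])
    then show ?thesis using lam1 by (simp only: I1 real_div_sqrt less_imp_le inner_scaleR_right)
  qed
  \<comment> \<open>The square of \<open>norm (S1 eta1)\<close> is
    \<open>eta1 \<bullet> adjoint S1 (S1 eta1)\<close>, that is, \<open>lam 1\<close> times the
    square of \<open>norm eta1\<close>.\<close>
  have "(norm g)\<^sup>2 = (norm eta1)\<^sup>2"
    using lam1 by (simp add: g_def power_mult_distrib power_divide)
      (simp add: power2_norm_eq_inner adjoint_works_hilbert[OF bl] eta1(1))
  then have ng: "norm g = 1" using eta1(2) by (simp only: power2_eq_iff_nonneg norm_ge_zero)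
  \<comment> \<open>Over an empty \<open>D1\<close> all vectors agree vacuously and would be equal,
    contradicting \<open>eta1 \<noteq> 0\<close>. A point of \<open>D1\<close> is what makes
    \<open>std_info\<close> nonempty below.\<close>
  have "eta1 \<noteq> 0" using eta1(2) by auto
  then have "D1 \<noteq> {}" using F1 unfolding rkhs_def by blast
  have le: "nI \<epsilon> d \<le> nS \<epsilon> d" if "0 < \<epsilon>" for \<epsilon> d
  proof -
    let ?S = "tensor_power_op d S1" and ?I = "tensor_power_functional d I1"
    let ?w = "tens (replicate d g)" and ?v = "sqrt (lam 1) *\<^sub>R eta1"
    note T = tensor_power_op_props[OF bl, of d]
    have "I1 = (\<lambda>f. f \<bullet> ?v)" using I1 by blast
    then have I: "?I = (\<lambda>f. f \<bullet> tens (replicate d ?v))"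
      by (simp only: tensor_power_functional_inner)
    \<comment> \<open>Bounded linear maps need only be compared on elementary tensors: in degree
      \<open>d\<close> the factors agree by \<open>I1g\<close>, and in every other degree both sides
      vanish.\<close>
    also have "\<dots> = (\<lambda>f. ?S f \<bullet> ?w)"
    proof (rule bounded_linear_fock_eqI)
      show "bounded_linear (\<lambda>f. ?S f \<bullet> ?w)"
        by (intro bounded_linear_compose[OF bounded_linear_inner_left T(1)])
      fix xs :: "'f list"
      show "tens xs \<bullet> tens (replicate d ?v) = ?S (tens xs) \<bullet> ?w"
        using I1g I1 by (auto simp: T(2) inner_tens intro!: prod.cong)
    qed (rule bounded_linear_inner_left)
    finally have IS: "?I = (\<lambda>f. ?S f \<bullet> ?w)" .
    \<comment> \<open>\<open>S0\<close> and \<open>I0\<close> enclose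
      \<open>sqrt (lam 1) ^ d\<close> between the initial errors, the lower bound for
      \<open>?I\<close> being attained at the tensor power of \<open>eta1\<close>. The reverse
      comparison is the case \<open>n = 0\<close> of the error inequality shown last.\<close>
    have S0: "minimal_error (tensor_power d) (std_info D1 ev d) (tensor_power d) ?S 0 \<le> sqrt (lam 1) ^ d"
      unfolding minimal_error_0[OF zero_in_tensor_power]
    proof (rule cSUP_least)
      show "{f \<in> tensor_power d. norm f \<le> 1} \<noteq> {}"
        using zero_in_tensor_power by (auto intro!: exI[of _ 0])
      fix f :: "'f fock" assume f: "f \<in> {f \<in> tensor_power d. norm f \<le> 1}"
      have "norm (?S f) \<le> onorm S1 ^ d * norm f"
        by (rule norm_tensor_power_op_le[OF bl onorm[OF bl] onorm_pos_le[OF bl]])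
      also have "\<dots> \<le> sqrt (lam 1) ^ d * 1"
        using f onorm_le_largest_eigenvalue[OF S1(1) lam(1)] lam1
        by (intro mult_mono power_mono real_le_rsqrt onorm_pos_le[OF bl]) auto
      finally show "norm (?S f) \<le> sqrt (lam 1) ^ d" by simp
    qed
    have I0: "sqrt (lam 1) ^ d \<le> minimal_error (tensor_power d) (std_info D1 ev d) UNIV ?I 0"
      unfolding minimal_error_0[OF UNIV_I]
    proof (rule cSUP_upper2)
      have "bounded_linear ?I" unfolding I by (rule bounded_linear_inner_left)
      from bdd_above_error[OF this, where n = 0 and L = "\<lambda>_ _. 0" and g = "\<lambda>_. 0"]
      show "bdd_above ((\<lambda>f. norm (?I f)) ` {f \<in> tensor_power d. norm f \<le> 1})" by simp
      show "tens (replicate d eta1) \<in> {f \<in> tensor_power d. norm f \<le> 1}"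
        by (simp add: tens_in_tensor_power norm_tens_replicate eta1(2))
      show "sqrt (lam 1) ^ d \<le> norm (?I (tens (replicate d eta1)))"
        using lam1 eta1(2) by (simp add: I inner_tens dot_square_norm)
    qed
    obtain t where "t \<in> D1" using \<open>D1 \<noteq> {}\<close> by blast
    then have ne: "std_info D1 ev d \<noteq> {}"
      unfolding std_info_def by (auto intro!: exI[of _ "replicate d t"])
    have "minimal_error (tensor_power d) (std_info D1 ev d) UNIV ?I n
        \<le> minimal_error (tensor_power d) (std_info D1 ev d) (tensor_power d) ?S n" for n
      unfolding IS
      by (rule minimal_error_inner_le[OF T(1) bounded_linear_std_info ne])
        (simp_all add: zero_in_tensor_power norm_tens_replicate ng)
    then show ?thesis
      unfolding nI nS
      by (rule info_complexity_mono[OF _ order_trans[OF S0 I0]]) (use that in simp)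
  qed
  \<comment> \<open>The curse is a lower bound and passes from \<open>nI\<close> up to
    \<open>nS\<close>; both tractability notions are upper bounds, so they pass down and their
    negations pass up.\<close>
  show ?thesis
    using curse_of_dimensionality_mono[of nI nS, OF le]
      quasi_polynomially_tractable_mono[of nI nS, OF le]
      polynomially_tractable_mono[of nI nS, OF le] by blast
qed

end
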